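(* Let $n\in\mathbb N$, let $X_1,\ldots,X_n$ be independent centered real random variables with variances $\sigma_1^2,\ldots,\sigma_n^2$ and finite third absolute moments $\beta_j=\mathsf E|X_j|^3$, and suppose $\sigma^2:=\sum_{j=1}^n\sigma_j^2>0$. Let $S_n:=(X_1+\ldots+X_n)/\sigma$, $\varepsilon_n:=\sigma^{-3}\sum_{j=1}^n\beta_j$, let $S_n^*$ have the $S_n$-zero biased distribution, and let $N$ be a standard normal random variable. Then $$\zeta_1(S_n,N)\le 2\,\zeta_1(S_n,S_n^* )\le\varepsilon_n,\qquad \zeta_2(S_n,N)\le\frac{\sqrt{2\pi}}4\,\zeta_1(S_n,S_n^* )\le\frac{\sqrt{2\pi}}8\,\varepsilon_n,$$ $$\zeta_3(S_n,N)\le\frac13\,\zeta_1(S_n,S_n^* )\le\frac16\,\varepsilon_n .$$ The last double inequality is optimal, namely: for every $\delta>0$ there exists a sequence $X_1,X_2,\ldots$ of i.i.d. centered random variables with positive variance and finite third absolute moment such that, with $S_n$ and $\varepsilon_n$ formed from $X_1,\ldots,X_n$ as described, $$\frac{\zeta_3(S_n,N)}{\varepsilon_n}\ge\frac16-\delta,\qquad n=1,2,\ldots$$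
   Context: Zero bias: for a zero-mean random variable $W$ with variance $s^2>0$, a random variable $W^*$ is said to have the $W$-zero biased distribution if $\mathsf E\,Wf(W)=s^2\,\mathsf E f'(W^* )$ for every differentiable $f:\mathbb R\to\mathbb R$ such that the left-hand side is defined. It is known that such a distribution exists and has density $p(w)=s^{-2}\mathsf E(W\mathbf 1\{W>w\})$ for $w\ge0$ and $p(w)=s^{-2}\mathsf E(-W\mathbf 1\{W<w\})$ for $w<0$. The metrics $\zeta_r$, $r\in\mathbb N$: for $f\in C^{(r-1)}(\mathbb R)$ (with $C^{(0)}(\mathbb R)=C(\mathbb R)$) let $M_r(f):=\sup_{x\ne y}\left|\frac{f^{(r-1)}(x)-f^{(r-1)}(y)}{x-y}\right|$, and $M_r(f)=\infty$ if $f\notin C^{(r-1)}(\mathbb R)$. Let $\mathcal F_r$ be the set of all real bounded functions on $\mathbb R$ with $M_r(f)\le1$. Then $\zeta_r(X,Y):=\sup\{|\mathsf Ef(X)-\mathsf Ef(Y)|: f\in\mathcal F_r\}$; it depends only on the distributions of $X$ and $Y$. *)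

theory Defs
  imports "HOL-Probability.Probability"
begin

definition C_diff :: "nat \<Rightarrow> (real \<Rightarrow> real) \<Rightarrow> bool" where
  "C_diff k f \<longleftrightarrow>
     (\<forall>j<k. \<forall>x. (deriv ^^ j) f differentiable at x) \<and> continuous_on UNIV ((deriv ^^ k) f)"

(* Intended for r \<ge> 1 only; r - 1 is truncated subtraction. *)
definition M_const :: "nat \<Rightarrow> (real \<Rightarrow> real) \<Rightarrow> ereal" where
  "M_const r f =
     (if C_diff (r - 1) f
      then (SUP (x, y)\<in>{(x, y). x \<noteq> y}.
              ereal \<bar>((deriv ^^ (r - 1)) f x - (deriv ^^ (r - 1)) f y) / (x - y)\<bar>)
      else \<infinity>)"

definition F_class :: "nat \<Rightarrow> (real \<Rightarrow> real) set" where
  "F_class r = {f. bounded (range f) \<and> M_const r f \<le> 1}"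

(* X and Y may live on different probability spaces. For r \<ge> 1 the functions in F_class r are
   bounded and continuous, so both integrals below are genuine expectations. *)
definition zeta ::
  "nat \<Rightarrow> 'a measure \<Rightarrow> ('a \<Rightarrow> real) \<Rightarrow> 'b measure \<Rightarrow> ('b \<Rightarrow> real) \<Rightarrow> ereal" where
  "zeta r P X Q Y =
     (SUP f\<in>F_class r. ereal \<bar>prob_space.expectation P (\<lambda>\<omega>. f (X \<omega>)) -
                                prob_space.expectation Q (\<lambda>\<omega>. f (Y \<omega>))\<bar>)"

(* V on Q has the W-zero biased distribution, for W on P with mean zero and positive variance.
   The identity is required only when both expectations exist. Existence of the left-hand side
   alone does not suffice: for W standard normal (where V is standard normal as well) and
   f x = sin (exp (x^2)), W * f W is integrable but f' V is not. The test functions with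
   continuous, compactly supported derivative already determine the law of V. *)
definition zero_biased ::
  "'a measure \<Rightarrow> ('a \<Rightarrow> real) \<Rightarrow> 'b measure \<Rightarrow> ('b \<Rightarrow> real) \<Rightarrow> bool" where
  "zero_biased P W Q V \<longleftrightarrow>
     prob_space Q \<and> V \<in> borel_measurable Q \<and>
     (\<forall>f::real \<Rightarrow> real.
        (\<forall>x. f differentiable at x) \<longrightarrow>
        integrable P (\<lambda>\<omega>. W \<omega> * f (W \<omega>)) \<longrightarrow>
        integrable Q (\<lambda>\<omega>. deriv f (V \<omega>)) \<longrightarrow>
        prob_space.expectation P (\<lambda>\<omega>. W \<omega> * f (W \<omega>)) =
          prob_space.variance P W * prob_space.expectation Q (\<lambda>\<omega>. deriv f (V \<omega>)))"

definition centered_L3 :: "'a measure \<Rightarrow> ('a \<Rightarrow> real) \<Rightarrow> bool" where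
  "centered_L3 P X \<longleftrightarrow>
     X \<in> borel_measurable P \<and> integrable P X \<and> prob_space.expectation P X = 0 \<and>
     integrable P (\<lambda>\<omega>. \<bar>X \<omega>\<bar> ^ 3)"

definition sigma_sum :: "'a measure \<Rightarrow> (nat \<Rightarrow> 'a \<Rightarrow> real) \<Rightarrow> nat \<Rightarrow> real" where
  "sigma_sum P X n = sqrt (\<Sum>j=1..n. prob_space.variance P (X j))"

definition norm_sum :: "'a measure \<Rightarrow> (nat \<Rightarrow> 'a \<Rightarrow> real) \<Rightarrow> nat \<Rightarrow> 'a \<Rightarrow> real" where
  "norm_sum P X n \<omega> = (\<Sum>j=1..n. X j \<omega>) / sigma_sum P X n"

definition lyapunov :: "'a measure \<Rightarrow> (nat \<Rightarrow> 'a \<Rightarrow> real) \<Rightarrow> nat \<Rightarrow> real" where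
  "lyapunov P X n =
     (\<Sum>j=1..n. prob_space.expectation P (\<lambda>\<omega>. \<bar>X j \<omega>\<bar> ^ 3)) / sigma_sum P X n ^ 3"

end

theory Submission
  imports Defs "HOL-Real_Asymp.Real_Asymp"
begin

text \<open>
  Write \<open>S\<close> for the normalized sum, \<open>V\<close> for its zero biased version, \<open>z\<close> for their first
  distance, and \<open>N\<close> for a standard normal variable.

  For \<open>z \<le> \<epsilon> / 2\<close>, let \<open>f\<close> be a 1-Lipschitz function with antiderivative \<open>F\<close>. A pointwise inequality in
  two variables, integrated over two independent copies of a centered variable \<open>X\<close>, gives
  \<open>E (X F(X)) - E X\<^sup>2 E f(X) \<le> E \<bar>X\<bar>\<^sup>3 / 2\<close>. Applying this to each summand conditionally on the others
  and adding up bounds \<open>E (S F(S)) - E f(S) = E f(V) - E f(S)\<close>.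

  For the first distance to \<open>N\<close>, the derivative of the Stein solution of a 1-Lipschitz function is
  2-Lipschitz, and the Stein identity turns the difference of expectations into a difference of this
  derivative between \<open>S\<close> and \<open>V\<close>. For the other two, differentiate
  \<open>E h(sin \<theta> S + cos \<theta> N)\<close> in \<open>\<theta>\<close>: zero biasing and Gaussian integration by parts give
  \<open>sin \<theta> cos \<theta> (E h''(sin \<theta> V + cos \<theta> N) - E h''(sin \<theta> S + cos \<theta> N))\<close>. Averaging over \<open>N\<close>
  makes \<open>h''\<close> Lipschitz, with constant \<open>sin \<theta>\<close> if \<open>h''\<close> is 1-Lipschitz and
  \<open>tan \<theta> E \<bar>N\<bar>\<close> if only \<open>h'\<close> is; integrating over \<open>[0, \<pi> / 2]\<close> yields the constants.

  For the optimality, the third moment of \<open>S\<close> divided by 6 is a lower bound of the third distance, and a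
  very skew two-point law has a third moment close to the third absolute moment.
\<close>

section \<open>A bound for the zero bias transformation\<close>

text \<open>Second-order Taylor bounds, expanded at the lower and at the upper endpoint. Right side
  minus left side vanishes when the endpoints meet, and its derivative in the moving endpoint has a
  fixed sign by the Lipschitz condition.\<close>

lemma antiderivative_lipschitz_le:
  fixes f F :: "real \<Rightarrow> real"
  assumes lip: "\<And>x y. \<bar>f x - f y\<bar> \<le> \<bar>x - y\<bar>"
    and F: "\<And>x. (F has_real_derivative f x) (at x)"
    and "y \<le> x"
  shows "F x - F y \<le> (x - y) * f y + (x - y)\<^sup>2 / 2"
    and "F x - F y \<le> (x - y) * f x + (x - y)\<^sup>2 / 2"
proof -
  have "(\<lambda>t. (t - y) * f y + (t - y)\<^sup>2 / 2 - F t) y \<le> (\<lambda>t. (t - y) * f y + (t - y)\<^sup>2 / 2 - F t) x"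
  proof (rule DERIV_nonneg_imp_nondecreasing[OF \<open>y \<le> x\<close>])
    fix t assume "y \<le> t" "t \<le> x"
    moreover have "((\<lambda>t. (t - y) * f y + (t - y)\<^sup>2 / 2 - F t) has_real_derivative f y + (t - y) - f t) (at t)"
      by (auto intro!: derivative_eq_intros F)
    moreover have "f t - f y \<le> t - y" using lip[of t y] \<open>y \<le> t\<close> by linarith
    ultimately show "\<exists>z. ((\<lambda>t. (t - y) * f y + (t - y)\<^sup>2 / 2 - F t) has_real_derivative z) (at t) \<and> 0 \<le> z"
      by (intro exI conjI) auto
  qed
  then show "F x - F y \<le> (x - y) * f y + (x - y)\<^sup>2 / 2" by simp
  have "(\<lambda>t. t * f x - (x - t)\<^sup>2 / 2 - F t) y \<le> (\<lambda>t. t * f x - (x - t)\<^sup>2 / 2 - F t) x"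
  proof (rule DERIV_nonneg_imp_nondecreasing[OF \<open>y \<le> x\<close>])
    fix t assume "y \<le> t" "t \<le> x"
    moreover have "((\<lambda>t. t * f x - (x - t)\<^sup>2 / 2 - F t) has_real_derivative f x + (x - t) - f t) (at t)"
      by (auto intro!: derivative_eq_intros F simp: field_simps)
    moreover have "f t - f x \<le> x - t" using lip[of t x] \<open>t \<le> x\<close> by linarith
    ultimately show "\<exists>z. ((\<lambda>t. t * f x - (x - t)\<^sup>2 / 2 - F t) has_real_derivative z) (at t) \<and> 0 \<le> z"
      by (intro exI conjI) auto
  qed
  then show "F x - F y \<le> (x - y) * f x + (x - y)\<^sup>2 / 2" by (simp add: algebra_simps)
qed

text \<open>Multiplied by \<open>x - y\<close> and rearranged, this becomes the two-variable
  inequality that is later integrated. For equal signs one Taylor step and the Lipschitz bound on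
  \<open>f x - f y\<close> suffice; for opposite signs the step is split.\<close>

lemma antiderivative_cross_le:
  fixes f F :: "real \<Rightarrow> real"
  assumes lip: "\<And>x y. \<bar>f x - f y\<bar> \<le> \<bar>x - y\<bar>"
    and F: "\<And>x. (F has_real_derivative f x) (at x)"
    and "y \<le> x"
  shows "F x - F y + y * f x - x * f y \<le> (x * \<bar>x\<bar> - y * \<bar>y\<bar>) / 2"
proof -
  note T = antiderivative_lipschitz_le[OF lip F]
  have d: "\<bar>f x - f y\<bar> \<le> x - y" using lip[of x y] \<open>y \<le> x\<close> by simp
  consider "0 \<le> y" | "x \<le> 0" | "y < 0" "0 < x" by linarith
  then show ?thesis
  proof cases
    case 1
    have "y * (f x - f y) \<le> y * (x - y)" using d 1 by (intro mult_left_mono) auto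
    with T(1)[OF \<open>y \<le> x\<close>] 1 \<open>y \<le> x\<close> show ?thesis
      by (simp add: power2_eq_square field_simps)
  next
    case 2
    have "(- x) * (f y - f x) \<le> (- x) * (x - y)" using d 2 by (intro mult_left_mono) auto
    with T(2)[OF \<open>y \<le> x\<close>] 2 \<open>y \<le> x\<close> show ?thesis
      by (simp add: power2_eq_square field_simps)
  next
    case 3
    \<comment> \<open>The point \<open>x + y\<close> lies between \<open>y\<close> and
      \<open>x\<close>. Stopping there produces exactly the terms \<open>- y * f x\<close> and
      \<open>x * f y\<close> that have to cancel.\<close>
    have "F x - F (x + y) \<le> - y * f x + y\<^sup>2 / 2" using T(2)[of "x + y" x] 3 by simp
    moreover have "F (x + y) - F y \<le> x * f y + x\<^sup>2 / 2" using T(1)[of y "x + y"] 3 by simp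
    ultimately show ?thesis using 3 by (simp add: power2_eq_square field_simps)
  qed
qed

text \<open>The function \<open>\<alpha>\<close> is chosen so that every pair \<open>x, y\<close> admits an \<open>f\<close> with equality;
  its contribution vanishes in the mean because the variables are centered.\<close>

lemma antiderivative_symmetrized_le:
  fixes f F :: "real \<Rightarrow> real" and x y :: real
  assumes lip: "\<And>x y. \<bar>f x - f y\<bar> \<le> \<bar>x - y\<bar>"
    and F: "\<And>x. (F has_real_derivative f x) (at x)"
  defines "\<alpha> \<equiv> \<lambda>x. F x - x * f x - x * \<bar>x\<bar> / 2"
  shows "x * F x + y * F y - y\<^sup>2 * f x - x\<^sup>2 * f y - x * \<alpha> y - y * \<alpha> x \<le> (\<bar>x\<bar> ^ 3 + \<bar>y\<bar> ^ 3) / 2"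
proof -
  \<comment> \<open>Both factors on each side change sign when \<open>x\<close> and \<open>y\<close>
    are exchanged, so the ordered case covers everything.\<close>
  have *: "(x - y) * (F x - F y + y * f x - x * f y) \<le> (x - y) * ((x * \<bar>x\<bar> - y * \<bar>y\<bar>) / 2)"
  proof (cases "y \<le> x")
    case True
    then show ?thesis by (intro mult_left_mono antiderivative_cross_le[OF lip F]) auto
  next
    case False
    then have "(y - x) * (F y - F x + x * f y - y * f x) \<le> (y - x) * ((y * \<bar>y\<bar> - x * \<bar>x\<bar>) / 2)"
      by (intro mult_left_mono antiderivative_cross_le[OF lip F]) auto
    then show ?thesis by (simp add: algebra_simps)
  qed
  have c: "\<bar>u\<bar> ^ 3 = u * u * \<bar>u\<bar>" for u :: real
    by (simp add: power3_eq_cube abs_mult)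
  \<comment> \<open>Adding \<open>x * y * (\<bar>x\<bar> + \<bar>y\<bar>) / 2\<close> to both sides
    gives the claim: on the left it completes the two terms with \<alpha>, on the right it removes
    the mixed terms.\<close>
  show ?thesis using * unfolding \<alpha>_def c
    by (simp add: field_simps power2_eq_square)
qed

section \<open>Integrability from third absolute moments, and integration over one summand\<close>

lemma integrable_real_dominated:
  fixes f g :: "'a \<Rightarrow> real"
  assumes "integrable M g" "f \<in> borel_measurable M" "\<And>x. \<bar>f x\<bar> \<le> g x"
  shows "integrable M f"
  using assms(1,2)
proof (rule Bochner_Integration.integrable_bound)
  show "AE x in M. norm (f x) \<le> norm (g x)"
    using order_trans[OF assms(3) abs_ge_self] by (intro AE_I2) simp
qed

lemma integrable_abs_cube_imp:
  fixes X :: "'a \<Rightarrow> real"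
  assumes "finite_measure M" "X \<in> borel_measurable M" "integrable M (\<lambda>\<omega>. \<bar>X \<omega>\<bar> ^ 3)"
  shows "integrable M X" "integrable M (\<lambda>\<omega>. (X \<omega>)\<^sup>2)" "integrable M (\<lambda>\<omega>. X \<omega> * \<bar>X \<omega>\<bar>)"
proof -
  interpret finite_measure M by fact
  have abs: "\<bar>u\<bar> \<le> 1 + \<bar>u\<bar> ^ 3" "\<bar>u\<^sup>2\<bar> \<le> 1 + \<bar>u\<bar> ^ 3" "\<bar>u * \<bar>u\<bar>\<bar> \<le> 1 + \<bar>u\<bar> ^ 3" for u :: real
  proof -
    \<comment> \<open>The product expands to \<open>1 + \<bar>u\<bar> ^ 3 - \<bar>u\<bar>\<^sup>2 -
      \<bar>u\<bar>\<close>, which bounds both lower powers at once.\<close>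
    have "0 \<le> (\<bar>u\<bar> + 1) * (\<bar>u\<bar> - 1)\<^sup>2" by simp
    then have "\<bar>u\<bar>\<^sup>2 + \<bar>u\<bar> \<le> 1 + \<bar>u\<bar> ^ 3"
      by (simp add: power2_eq_square power3_eq_cube algebra_simps del: zero_le_mult_iff)
    moreover have "0 \<le> \<bar>u\<bar>\<^sup>2" "0 \<le> \<bar>u\<bar>" by simp_all
    moreover have "\<bar>u\<^sup>2\<bar> = \<bar>u\<bar>\<^sup>2" "\<bar>u * \<bar>u\<bar>\<bar> = \<bar>u\<bar>\<^sup>2"
      by (simp_all add: abs_mult power2_eq_square)
    ultimately show "\<bar>u\<bar> \<le> 1 + \<bar>u\<bar> ^ 3" "\<bar>u\<^sup>2\<bar> \<le> 1 + \<bar>u\<bar> ^ 3" "\<bar>u * \<bar>u\<bar>\<bar> \<le> 1 + \<bar>u\<bar> ^ 3"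
      by linarith+
  qed
  have g: "integrable M (\<lambda>\<omega>. 1 + \<bar>X \<omega>\<bar> ^ 3)" using assms(3) by simp
  note [measurable] = assms(2)
  show "integrable M X" "integrable M (\<lambda>\<omega>. (X \<omega>)\<^sup>2)" "integrable M (\<lambda>\<omega>. X \<omega> * \<bar>X \<omega>\<bar>)"
    by (rule integrable_real_dominated[OF g _ abs(1)] integrable_real_dominated[OF g _ abs(2)]
        integrable_real_dominated[OF g _ abs(3)], measurable)+
qed

lemma antiderivative_linear_growth:
  fixes f F :: "real \<Rightarrow> real"
  assumes B: "\<And>x. \<bar>f x\<bar> \<le> B"
    and F: "\<And>x. (F has_real_derivative f x) (at x)"
  shows "\<bar>F x\<bar> \<le> \<bar>F 0\<bar> + B * \<bar>x\<bar>"
proof -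
  have "\<bar>F x - F 0\<bar> \<le> B * \<bar>x - 0\<bar>"
    using field_differentiable_bound[of UNIV F f B x 0] F B by auto
  then show ?thesis unfolding diff_0_right by linarith
qed

text \<open>The symmetrized inequality is integrated in \<open>x\<close> and then in
  \<open>y\<close> against the same centered law. Each wanted term occurs twice, the \<alpha> terms
  drop out, and halving leaves the constant 1/2.\<close>

lemma zero_bias_functional_le:
  fixes \<mu> :: "real measure" and f F :: "real \<Rightarrow> real"
  assumes "prob_space \<mu>" and [measurable_cong]: "sets \<mu> = sets borel"
    and i3: "integrable \<mu> (\<lambda>x. \<bar>x\<bar> ^ 3)" and mean: "(\<integral>x. x \<partial>\<mu>) = 0"
    and lip: "\<And>x y. \<bar>f x - f y\<bar> \<le> \<bar>x - y\<bar>" and B: "\<And>x. \<bar>f x\<bar> \<le> B"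
    and F: "\<And>x. (F has_real_derivative f x) (at x)"
  shows "(\<integral>x. x * F x \<partial>\<mu>) - (\<integral>x. x\<^sup>2 \<partial>\<mu>) * (\<integral>x. f x \<partial>\<mu>) \<le> (\<integral>x. \<bar>x\<bar> ^ 3 \<partial>\<mu>) / 2"
proof -
  interpret prob_space \<mu> by fact
  define \<alpha> where "\<alpha> = (\<lambda>x. F x - x * f x - x * \<bar>x\<bar> / 2)"
  have cf: "continuous_on UNIV f"
    by (rule lipschitz_on_continuous_on[of 1]) (auto intro!: lipschitz_onI simp: dist_real_def lip)
  have cF: "continuous_on UNIV F"
    using F by (meson DERIV_isCont continuous_at_imp_continuous_on)
  have [measurable]: "f \<in> borel_measurable borel" "F \<in> borel_measurable borel"
    using cf cF by (auto intro: borel_measurable_continuous_onI)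
  have [measurable]: "\<alpha> \<in> borel_measurable borel" unfolding \<alpha>_def by measurable
  have idm: "(\<lambda>x. x) \<in> borel_measurable \<mu>" by measurable
  note I = integrable_abs_cube_imp[OF finite_measure_axioms idm i3]
  have i1: "integrable \<mu> (\<lambda>x. x)" and i2: "integrable \<mu> (\<lambda>x. x\<^sup>2)" and i2': "integrable \<mu> (\<lambda>x. x * \<bar>x\<bar>)"
    by (rule I)+
  have gF: "\<bar>F x\<bar> \<le> \<bar>F 0\<bar> + B * \<bar>x\<bar>" for x
    by (rule antiderivative_linear_growth[of f B F, OF B F])
  have iF: "integrable \<mu> F"
  proof (rule integrable_real_dominated)
    show "integrable \<mu> (\<lambda>x. \<bar>F 0\<bar> + B * \<bar>x\<bar>)" using i1 by simp
  qed (measurable, rule gF)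
  have ixF: "integrable \<mu> (\<lambda>x. x * F x)"
  proof (rule integrable_real_dominated)
    show "integrable \<mu> (\<lambda>x. \<bar>F 0\<bar> * \<bar>x\<bar> + B * x\<^sup>2)" using i1 i2 by simp
    fix x :: real
    have "\<bar>x\<bar> * \<bar>F x\<bar> \<le> \<bar>x\<bar> * (\<bar>F 0\<bar> + B * \<bar>x\<bar>)" by (intro mult_left_mono gF) auto
    also have "\<dots> = \<bar>F 0\<bar> * \<bar>x\<bar> + B * x\<^sup>2" by (simp add: algebra_simps power2_eq_square)
    finally show "\<bar>x * F x\<bar> \<le> \<bar>F 0\<bar> * \<bar>x\<bar> + B * x\<^sup>2" by (simp add: abs_mult)
  qed simp
  have if': "integrable \<mu> f"
    by (rule integrable_const_bound[of _ B]) (use B in auto)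
  have ixf: "integrable \<mu> (\<lambda>x. x * f x)"
  proof (rule integrable_real_dominated)
    show "integrable \<mu> (\<lambda>x. \<bar>x\<bar> * B)" using i1 by simp
    show "\<bar>x * f x\<bar> \<le> \<bar>x\<bar> * B" for x
      unfolding abs_mult by (intro mult_left_mono B) simp
  qed simp
  have i\<alpha>: "integrable \<mu> \<alpha>" unfolding \<alpha>_def using iF ixf i2' by simp
  define A m a s \<beta> where "A = (\<integral>x. x * F x \<partial>\<mu>)" and "m = (\<integral>x. f x \<partial>\<mu>)" and "a = (\<integral>x. \<alpha> x \<partial>\<mu>)"
    and "s = (\<integral>x. x\<^sup>2 \<partial>\<mu>)" and "\<beta> = (\<integral>x. \<bar>x\<bar> ^ 3 \<partial>\<mu>)"
  have E1: "A + y * F y - y\<^sup>2 * m - s * f y - y * a \<le> (\<beta> + \<bar>y\<bar> ^ 3) / 2" for y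
  proof -
    have "(\<integral>x. x * F x + y * F y - y\<^sup>2 * f x - x\<^sup>2 * f y - x * \<alpha> y - y * \<alpha> x \<partial>\<mu>) \<le> (\<integral>x. (\<bar>x\<bar> ^ 3 + \<bar>y\<bar> ^ 3) / 2 \<partial>\<mu>)"
      by (intro integral_mono) (use ixF if' i2 i1 i\<alpha> i3 antiderivative_symmetrized_le[OF lip F] in \<open>auto simp: \<alpha>_def\<close>)
    moreover have "(\<integral>x. x * F x + y * F y - y\<^sup>2 * f x - x\<^sup>2 * f y - x * \<alpha> y - y * \<alpha> x \<partial>\<mu>)
      = A + y * F y - y\<^sup>2 * m - s * f y - 0 * \<alpha> y - y * a"
      \<comment> \<open>The literal \<open>0\<close> in the claim stands for the mean; turning it
        back into an integral makes the equation plain linearity. The term \<open>y * a\<close>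
        survives here and vanishes only in the integration over \<open>y\<close>.\<close>
      unfolding A_def m_def s_def a_def mean[symmetric]
      using ixF if' i2 i1 i\<alpha> by (simp add: prob_space)
    moreover have "(\<integral>x. (\<bar>x\<bar> ^ 3 + \<bar>y\<bar> ^ 3) / 2 \<partial>\<mu>) = (\<beta> + \<bar>y\<bar> ^ 3) / 2"
      using i3 unfolding \<beta>_def by (simp add: prob_space)
    ultimately show ?thesis by simp
  qed
  have "(\<integral>y. A + y * F y - y\<^sup>2 * m - s * f y - y * a \<partial>\<mu>) \<le> (\<integral>y. (\<beta> + \<bar>y\<bar> ^ 3) / 2 \<partial>\<mu>)"
    by (intro integral_mono) (use ixF if' i2 i1 i3 E1 in auto)
  moreover have "(\<integral>y. A + y * F y - y\<^sup>2 * m - s * f y - y * a \<partial>\<mu>) = A + A - s * m - s * m - 0 * a"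
    unfolding mean[symmetric] using ixF if' i2 i1
    by (simp add: prob_space A_def[symmetric] m_def[symmetric] s_def[symmetric])
  moreover have "(\<integral>y. (\<beta> + \<bar>y\<bar> ^ 3) / 2 \<partial>\<mu>) = (\<beta> + \<beta>) / 2"
    using i3 by (simp add: prob_space \<beta>_def[symmetric])
  ultimately have "A + A - s * m - s * m - 0 * a \<le> (\<beta> + \<beta>) / 2" by (simp only:)
  then have "A - s * m \<le> \<beta> / 2" by (simp add: mult.commute)
  then show ?thesis unfolding A_def m_def s_def \<beta>_def .
qed

text \<open>For fixed \<open>t\<close> the shifted functions \<open>f (t + x)\<close> and
  \<open>F (t + x)\<close> satisfy the same hypotheses, so the one-variable bound applies to the law
  of \<open>X\<close> with a right side free of \<open>t\<close>. Independence lets it be integrated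
  over the law of \<open>T\<close>.\<close>

lemma (in prob_space) zero_bias_functional_indep_le:
  fixes X T :: "'a \<Rightarrow> real" and f F :: "real \<Rightarrow> real"
  assumes indep: "indep_var borel X borel T" and X: "centered_L3 M X" and T: "integrable M T"
    and lip: "\<And>x y. \<bar>f x - f y\<bar> \<le> \<bar>x - y\<bar>" and B: "\<And>x. \<bar>f x\<bar> \<le> B"
    and F: "\<And>x. (F has_real_derivative f x) (at x)"
  shows "integrable M (\<lambda>\<omega>. X \<omega> * F (T \<omega> + X \<omega>))"
    and "expectation (\<lambda>\<omega>. X \<omega> * F (T \<omega> + X \<omega>))
        - expectation (\<lambda>\<omega>. (X \<omega>)\<^sup>2) * expectation (\<lambda>\<omega>. f (T \<omega> + X \<omega>))
      \<le> expectation (\<lambda>\<omega>. \<bar>X \<omega>\<bar> ^ 3) / 2"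
proof -
  have [measurable]: "X \<in> borel_measurable M" "T \<in> borel_measurable M"
    using X T by (auto simp: centered_L3_def)
  have i1: "integrable M X" and i3: "integrable M (\<lambda>\<omega>. \<bar>X \<omega>\<bar> ^ 3)" and mean: "expectation X = 0"
    using X by (auto simp: centered_L3_def)
  have i2: "integrable M (\<lambda>\<omega>. (X \<omega>)\<^sup>2)"
    by (rule integrable_abs_cube_imp[OF finite_measure_axioms _ i3]) measurable
  have cf: "continuous_on UNIV f"
    by (rule lipschitz_on_continuous_on[of 1]) (auto intro!: lipschitz_onI simp: dist_real_def lip)
  have cF: "continuous_on UNIV F"
    using F by (meson DERIV_isCont continuous_at_imp_continuous_on)
  have [measurable]: "f \<in> borel_measurable borel" "F \<in> borel_measurable borel"
    using cf cF by (auto intro: borel_measurable_continuous_onI)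
  have gF: "\<bar>F x\<bar> \<le> \<bar>F 0\<bar> + B * \<bar>x\<bar>" for x
    by (rule antiderivative_linear_growth[of f B F, OF B F])
  have B0: "0 \<le> B" using B[of 0] by linarith
  \<comment> \<open>\<open>F\<close> grows at most linearly, so \<open>X * F (T + X)\<close> is
    dominated through \<open>X\<close>, \<open>X * T\<close> and the square of \<open>X\<close>; the
    product is integrable by independence and first moments.\<close>
  have iXT: "integrable M (\<lambda>\<omega>. X \<omega> * T \<omega>)" by (rule indep_var_integrable[OF indep i1 T])
  show iXF: "integrable M (\<lambda>\<omega>. X \<omega> * F (T \<omega> + X \<omega>))"
  proof (rule integrable_real_dominated)
    show "integrable M (\<lambda>\<omega>. \<bar>F 0\<bar> * \<bar>X \<omega>\<bar> + B * \<bar>X \<omega> * T \<omega>\<bar> + B * (X \<omega>)\<^sup>2)"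
      using i1 i2 iXT by simp
    fix \<omega>
    have "\<bar>X \<omega>\<bar> * \<bar>F (T \<omega> + X \<omega>)\<bar> \<le> \<bar>X \<omega>\<bar> * (\<bar>F 0\<bar> + B * (\<bar>T \<omega>\<bar> + \<bar>X \<omega>\<bar>))"
      by (intro mult_left_mono order_trans[OF gF] add_left_mono B0) auto
    then show "\<bar>X \<omega> * F (T \<omega> + X \<omega>)\<bar> \<le> \<bar>F 0\<bar> * \<bar>X \<omega>\<bar> + B * \<bar>X \<omega> * T \<omega>\<bar> + B * (X \<omega>)\<^sup>2"
      by (simp add: abs_mult algebra_simps power2_eq_square)
  qed measurable
  define \<mu> \<tau> where "\<mu> = distr M borel X" and "\<tau> = distr M borel T"
  interpret \<mu>: prob_space \<mu> unfolding \<mu>_def by (rule prob_space_distr) measurable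
  interpret \<tau>: prob_space \<tau> unfolding \<tau>_def by (rule prob_space_distr) measurable
  interpret P: pair_sigma_finite \<mu> \<tau> ..
  have [measurable_cong]: "sets \<mu> = sets borel" "sets \<tau> = sets borel"
    by (simp_all add: \<mu>_def \<tau>_def)
  have joint: "\<mu> \<Otimes>\<^sub>M \<tau> = distr M (borel \<Otimes>\<^sub>M borel) (\<lambda>\<omega>. (X \<omega>, T \<omega>))"
    using indep unfolding indep_var_distribution_eq \<mu>_def \<tau>_def by blast
  have jXF: "integrable (\<mu> \<Otimes>\<^sub>M \<tau>) (\<lambda>(x, t). x * F (t + x))"
    unfolding joint by (subst integrable_distr_eq) (use iXF in \<open>simp_all\<close>)
  have jf: "integrable (\<mu> \<Otimes>\<^sub>M \<tau>) (\<lambda>(x, t). f (t + x))"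
    unfolding joint
  proof (subst integrable_distr_eq)
    show "integrable M (\<lambda>\<omega>. case (X \<omega>, T \<omega>) of (x, t) \<Rightarrow> f (t + x))"
      by (rule integrable_const_bound[of _ B]) (simp_all add: B)
  qed measurable
  have EXF: "expectation (\<lambda>\<omega>. X \<omega> * F (T \<omega> + X \<omega>)) = (\<integral>t. (\<integral>x. x * F (t + x) \<partial>\<mu>) \<partial>\<tau>)"
    unfolding P.integral_snd[OF jXF] unfolding joint by (subst integral_distr) simp_all
  have Ef: "expectation (\<lambda>\<omega>. f (T \<omega> + X \<omega>)) = (\<integral>t. (\<integral>x. f (t + x) \<partial>\<mu>) \<partial>\<tau>)"
    unfolding P.integral_snd[OF jf] unfolding joint by (subst integral_distr) simp_all
  have k1: "integrable \<tau> (\<lambda>t. \<integral>x. x * F (t + x) \<partial>\<mu>)"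
    using P.integrable_snd[OF jXF] by simp
  have k2: "integrable \<tau> (\<lambda>t. \<integral>x. f (t + x) \<partial>\<mu>)"
    using P.integrable_snd[OF jf] by simp
  define s \<beta> where "s = expectation (\<lambda>\<omega>. (X \<omega>)\<^sup>2)" and "\<beta> = expectation (\<lambda>\<omega>. \<bar>X \<omega>\<bar> ^ 3)"
  have s: "s = (\<integral>x. x\<^sup>2 \<partial>\<mu>)" unfolding s_def \<mu>_def by (subst integral_distr) simp_all
  have \<beta>: "\<beta> = (\<integral>x. \<bar>x\<bar> ^ 3 \<partial>\<mu>)" unfolding \<beta>_def \<mu>_def by (subst integral_distr) simp_all
  have "(\<integral>x. x * F (t + x) \<partial>\<mu>) - s * (\<integral>x. f (t + x) \<partial>\<mu>) \<le> \<beta> / 2" for t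
    unfolding s \<beta>
  proof (rule zero_bias_functional_le)
    show "integrable \<mu> (\<lambda>x. \<bar>x\<bar> ^ 3)" unfolding \<mu>_def by (subst integrable_distr_eq) (use i3 in simp_all)
    show "(\<integral>x. x \<partial>\<mu>) = 0" unfolding \<mu>_def by (subst integral_distr) (use mean in simp_all)
    show "((\<lambda>x. F (t + x)) has_real_derivative f (t + x)) (at x)" for x
      using DERIV_shift[of F "f (t + x)" x t] F[of "t + x"] by (simp add: add.commute)
    show "\<bar>f (t + x) - f (t + y)\<bar> \<le> \<bar>x - y\<bar>" for x y using lip[of "t + x" "t + y"] by simp
    show "\<bar>f (t + x)\<bar> \<le> B" for x by (rule B)
  qed (fact \<mu>.prob_space_axioms, simp add: \<mu>_def)
  then have "(\<integral>t. (\<integral>x. x * F (t + x) \<partial>\<mu>) - s * (\<integral>x. f (t + x) \<partial>\<mu>) \<partial>\<tau>) \<le> (\<integral>t. \<beta> / 2 \<partial>\<tau>)"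
    using k1 k2 by (intro integral_mono) simp_all
  also have "(\<integral>t. \<beta> / 2 \<partial>\<tau>) = \<beta> / 2" by (simp add: \<tau>.prob_space)
  finally show "expectation (\<lambda>\<omega>. X \<omega> * F (T \<omega> + X \<omega>)) - s * expectation (\<lambda>\<omega>. f (T \<omega> + X \<omega>)) \<le> \<beta> / 2"
    unfolding EXF Ef using k1 k2 by simp
qed

text \<open>Each \<open>X j\<close> is paired with the sum \<open>T\<close> of the other variables.
  The factor \<open>expectation (\<lambda>\<omega>. f (S \<omega>))\<close> is the same for every
  \<open>j\<close>, so the bounds add up and the second moments combine into one
  coefficient.\<close>

lemma (in prob_space) zero_bias_functional_sum_le:
  fixes X :: "'i \<Rightarrow> 'a \<Rightarrow> real" and f F :: "real \<Rightarrow> real"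
  assumes I: "finite I" and indep: "indep_vars (\<lambda>_. borel) X I"
    and X: "\<And>j. j \<in> I \<Longrightarrow> centered_L3 M (X j)"
    and lip: "\<And>x y. \<bar>f x - f y\<bar> \<le> \<bar>x - y\<bar>" and B: "\<And>x. \<bar>f x\<bar> \<le> B"
    and F: "\<And>x. (F has_real_derivative f x) (at x)"
  defines "S \<equiv> \<lambda>\<omega>. \<Sum>j\<in>I. X j \<omega>"
  shows "integrable M (\<lambda>\<omega>. S \<omega> * F (S \<omega>))"
    and "expectation (\<lambda>\<omega>. S \<omega> * F (S \<omega>))
        - (\<Sum>j\<in>I. expectation (\<lambda>\<omega>. (X j \<omega>)\<^sup>2)) * expectation (\<lambda>\<omega>. f (S \<omega>))
      \<le> (\<Sum>j\<in>I. expectation (\<lambda>\<omega>. \<bar>X j \<omega>\<bar> ^ 3)) / 2"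
proof -
  have int: "integrable M (\<lambda>\<omega>. X j \<omega> * F (S \<omega>))"
    and le: "expectation (\<lambda>\<omega>. X j \<omega> * F (S \<omega>)) - expectation (\<lambda>\<omega>. (X j \<omega>)\<^sup>2) * expectation (\<lambda>\<omega>. f (S \<omega>))
      \<le> expectation (\<lambda>\<omega>. \<bar>X j \<omega>\<bar> ^ 3) / 2" if j: "j \<in> I" for j
  proof -
    define T where "T = (\<lambda>\<omega>. \<Sum>i\<in>I - {j}. X i \<omega>)"
    have T: "integrable M T"
      unfolding T_def using X by (auto simp: centered_L3_def)
    have S: "S \<omega> = T \<omega> + X j \<omega>" for \<omega>
      unfolding S_def T_def using I j by (simp add: sum.remove)
    have ind: "indep_var borel (X j) borel T"
      unfolding T_def using indep I j by (intro indep_vars_sum) (auto simp: insert_absorb)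
    note Z = zero_bias_functional_indep_le[OF ind X[OF j] T lip B F]
    show "integrable M (\<lambda>\<omega>. X j \<omega> * F (S \<omega>))" unfolding S by (rule Z)
    show "expectation (\<lambda>\<omega>. X j \<omega> * F (S \<omega>)) - expectation (\<lambda>\<omega>. (X j \<omega>)\<^sup>2) * expectation (\<lambda>\<omega>. f (S \<omega>))
      \<le> expectation (\<lambda>\<omega>. \<bar>X j \<omega>\<bar> ^ 3) / 2" unfolding S by (rule Z)
  qed
  have SF: "S \<omega> * F (S \<omega>) = (\<Sum>j\<in>I. X j \<omega> * F (S \<omega>))" for \<omega>
    unfolding S_def by (simp add: sum_distrib_right)
  show "integrable M (\<lambda>\<omega>. S \<omega> * F (S \<omega>))"
    unfolding SF using int by (intro Bochner_Integration.integrable_sum)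
  have "expectation (\<lambda>\<omega>. S \<omega> * F (S \<omega>)) = (\<Sum>j\<in>I. expectation (\<lambda>\<omega>. X j \<omega> * F (S \<omega>)))"
    unfolding SF using int by (intro Bochner_Integration.integral_sum)
  then show "expectation (\<lambda>\<omega>. S \<omega> * F (S \<omega>))
        - (\<Sum>j\<in>I. expectation (\<lambda>\<omega>. (X j \<omega>)\<^sup>2)) * expectation (\<lambda>\<omega>. f (S \<omega>))
      \<le> (\<Sum>j\<in>I. expectation (\<lambda>\<omega>. \<bar>X j \<omega>\<bar> ^ 3)) / 2"
    using sum_mono[of I, OF le]
    by (simp add: sum_subtractf sum_distrib_right sum_divide_distrib)
qed

text \<open>In \<open>X j * S\<close> the sum of the other variables contributes mean zero by
  independence, leaving the square of \<open>X j\<close>. This later gives the normalized sum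
  variance one.\<close>

lemma (in prob_space) expectation_square_sum:
  fixes X :: "'i \<Rightarrow> 'a \<Rightarrow> real"
  assumes I: "finite I" and indep: "indep_vars (\<lambda>_. borel) X I"
    and X: "\<And>j. j \<in> I \<Longrightarrow> centered_L3 M (X j)"
  shows "integrable M (\<lambda>\<omega>. (\<Sum>j\<in>I. X j \<omega>)\<^sup>2)"
    and "expectation (\<lambda>\<omega>. (\<Sum>j\<in>I. X j \<omega>)\<^sup>2) = (\<Sum>j\<in>I. expectation (\<lambda>\<omega>. (X j \<omega>)\<^sup>2))"
proof -
  define S where "S = (\<lambda>\<omega>. \<Sum>j\<in>I. X j \<omega>)"
  have *: "integrable M (\<lambda>\<omega>. X j \<omega> * S \<omega>)" (is ?A)
    "expectation (\<lambda>\<omega>. X j \<omega> * S \<omega>) = expectation (\<lambda>\<omega>. (X j \<omega>)\<^sup>2)" (is ?B) if j: "j \<in> I" for j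
  proof -
    define T where "T = (\<lambda>\<omega>. \<Sum>i\<in>I - {j}. X i \<omega>)"
    have T: "integrable M T"
      unfolding T_def using X by (auto simp: centered_L3_def)
    have S: "S \<omega> = T \<omega> + X j \<omega>" for \<omega>
      unfolding S_def T_def using I j by (simp add: sum.remove)
    have ind: "indep_var borel (X j) borel T"
      unfolding T_def using indep I j by (intro indep_vars_sum) (auto simp: insert_absorb)
    have Xj: "X j \<in> borel_measurable M" "integrable M (X j)" "expectation (X j) = 0"
      "integrable M (\<lambda>\<omega>. \<bar>X j \<omega>\<bar> ^ 3)" using X[OF j] by (auto simp: centered_L3_def)
    note i2 = integrable_abs_cube_imp(2)[OF finite_measure_axioms Xj(1,4)]
    note iXT = indep_var_integrable[OF ind Xj(2) T]
    have "expectation (\<lambda>\<omega>. X j \<omega> * T \<omega>) = 0"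
      using indep_var_lebesgue_integral[OF ind Xj(2) T] Xj(3) by simp
    then show ?A ?B
      using i2 iXT unfolding S distrib_left power2_eq_square by simp_all
  qed
  have SS: "(\<Sum>j\<in>I. X j \<omega>)\<^sup>2 = (\<Sum>j\<in>I. X j \<omega> * S \<omega>)" for \<omega>
    by (simp add: S_def power2_eq_square sum_distrib_right)
  show "integrable M (\<lambda>\<omega>. (\<Sum>j\<in>I. X j \<omega>)\<^sup>2)"
    unfolding SS using * by (intro Bochner_Integration.integrable_sum)
  have "expectation (\<lambda>\<omega>. (\<Sum>j\<in>I. X j \<omega>)\<^sup>2) = (\<Sum>j\<in>I. expectation (\<lambda>\<omega>. X j \<omega> * S \<omega>))"
    unfolding SS using * by (intro Bochner_Integration.integral_sum)
  then show "expectation (\<lambda>\<omega>. (\<Sum>j\<in>I. X j \<omega>)\<^sup>2) = (\<Sum>j\<in>I. expectation (\<lambda>\<omega>. (X j \<omega>)\<^sup>2))"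
    using * by simp
qed

section \<open>The Stein equation for Lipschitz test functions\<close>

lemma set_integrable_lborelI:
  fixes g :: "real \<Rightarrow> real"
  assumes "integrable lborel g" "A \<in> sets borel"
  shows "set_integrable lborel A g"
  unfolding set_integrable_def using assms by (intro integrable_mult_indicator) simp_all

lemma lborel_integral_split_at:
  fixes g :: "real \<Rightarrow> real"
  assumes "integrable lborel g"
  shows "(\<integral>t. g t \<partial>lborel) = (LINT t:{..<x}|lborel. g t) + (LINT t:{x<..}|lborel. g t)"
proof -
  have "(LINT t:UNIV|lborel. g t) = (LINT t:{..<x} \<union> {x<..}|lborel. g t)"
    by (rule set_integral_discrete_difference[where X = "{x}"]) auto
  also have "\<dots> = (LINT t:{..<x}|lborel. g t) + (LINT t:{x<..}|lborel. g t)"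
    using assms by (intro set_integral_Un set_integrable_lborelI) auto
  finally show ?thesis by (simp add: set_lebesgue_integral_def)
qed

text \<open>Splitting at 0 reduces the infinite range to a constant plus an integral over a bounded
  interval, where an antiderivative \<open>G\<close> of the continuous integrand is available.
  Needed to differentiate the numerator of the Stein solution.\<close>

lemma has_real_derivative_lower_integral:
  fixes g :: "real \<Rightarrow> real"
  assumes int: "integrable lborel g" and cont: "continuous_on UNIV g"
  shows "((\<lambda>x. LINT t:{..<x}|lborel. g t) has_real_derivative g x) (at x)"
proof -
  have ic: "isCont g y" for y using cont by (simp add: continuous_on_eq_continuous_at)
  have "\<exists>G. \<forall>x. - \<infinity> < ereal x \<longrightarrow> ereal x < \<infinity> \<longrightarrow> (G has_vector_derivative g x) (at x)"
    by (rule einterval_antiderivative) (simp_all add: ic)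
  then obtain G where G: "(G has_vector_derivative g x) (at x)" for x by auto
  define a where "a = (\<lambda>x. LINT t:{..<x}|lborel. g t)"
  have a_eq: "a y = (LBINT t=-\<infinity>..ereal y. g t)" for y
    unfolding a_def interval_lebesgue_integral_def by simp
  have "a y = a 0 + (G y - G 0)" for y
  proof -
    have "(LBINT t=-\<infinity>..ereal 0. g t) + (LBINT t=ereal 0..ereal y. g t) = (LBINT t=-\<infinity>..ereal y. g t)"
      by (rule interval_integral_sum)
        (auto simp: interval_lebesgue_integrable_def intro!: set_integrable_lborelI int)
    moreover have "(LBINT t=ereal 0..ereal y. g t) = G y - G 0"
      by (rule interval_integral_FTC_finite)
        (auto intro: continuous_on_subset[OF cont] has_vector_derivative_at_within G)
    ultimately show ?thesis unfolding a_eq by simp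
  qed
  then have "a = (\<lambda>y. a 0 + (G y - G 0))" by (rule ext)
  moreover have "((\<lambda>y. a 0 + (G y - G 0)) has_real_derivative g x) (at x)"
    using G[of x] unfolding has_real_derivative_iff_has_vector_derivative[symmetric]
    by (auto intro!: derivative_eq_intros)
  ultimately show ?thesis unfolding a_def by metis
qed

lemma lborel_integral_half_line_FTC:
  fixes G g :: "real \<Rightarrow> real"
  assumes int: "integrable lborel g" and cont: "continuous_on UNIV g"
    and G: "\<And>x. (G has_real_derivative g x) (at x)"
  shows "(G \<longlongrightarrow> A) at_bot \<Longrightarrow> (LINT t:{..<x}|lborel. g t) = G x - A"
    and "(G \<longlongrightarrow> B) at_top \<Longrightarrow> (LINT t:{x<..}|lborel. g t) = B - G x"
proof -
  have ic: "isCont g y" for y using cont by (simp add: continuous_on_eq_continuous_at)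
  have V: "(G has_vector_derivative g y) (at y)" for y
    using G[of y] by (simp add: has_real_derivative_iff_has_vector_derivative)
  have GC: "(G \<longlongrightarrow> G x) (at x)" using G[of x] DERIV_isCont isContD by blast
  then have GL: "(G \<longlongrightarrow> G x) (at_left x)" and GR: "(G \<longlongrightarrow> G x) (at_right x)"
    by (simp_all add: filterlim_at_split)
  show "(LINT t:{..<x}|lborel. g t) = G x - A" if A: "(G \<longlongrightarrow> A) at_bot"
  proof -
    have "(LBINT t=-\<infinity>..ereal x. g t) = G x - A"
      by (rule interval_integral_FTC_integrable[where F = G])
        (auto simp: ereal_tendsto_simps A GL V ic intro!: set_integrable_lborelI int)
    then show ?thesis by (simp add: interval_lebesgue_integral_def)
  qed
  show "(LINT t:{x<..}|lborel. g t) = B - G x" if B: "(G \<longlongrightarrow> B) at_top"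
  proof -
    have "(LBINT t=ereal x..\<infinity>. g t) = B - G x"
      by (rule interval_integral_FTC_integrable[where F = G])
        (auto simp: ereal_tendsto_simps B GR V ic intro!: set_integrable_lborelI int)
    then show ?thesis by (simp add: interval_lebesgue_integral_def)
  qed
qed

lemma lborel_integral_FTC:
  fixes G g :: "real \<Rightarrow> real"
  assumes int: "integrable lborel g" and cont: "continuous_on UNIV g"
    and G: "\<And>x. (G has_real_derivative g x) (at x)"
    and A: "(G \<longlongrightarrow> A) at_bot" and B: "(G \<longlongrightarrow> B) at_top"
  shows "(\<integral>t. g t \<partial>lborel) = B - A"
  using lborel_integral_split_at[OF int, of 0] lborel_integral_half_line_FTC(1)[OF int cont G A, of 0]
    lborel_integral_half_line_FTC(2)[OF int cont G B, of 0] by simp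

section \<open>The standard normal density, its Mills ratio and the Stein solution\<close>

abbreviation (input) \<phi> :: "real \<Rightarrow> real" where "\<phi> \<equiv> std_normal_density"

lemma std_normal_density_pos [simp]: "0 < \<phi> x"
  by (simp add: std_normal_density_def)

lemma DERIV_std_normal_density [derivative_intros]:
  "(f has_real_derivative f') (at x) \<Longrightarrow>
    ((\<lambda>x. \<phi> (f x)) has_real_derivative (- f x * \<phi> (f x) * f')) (at x)"
  unfolding std_normal_density_def
  by (auto intro!: derivative_eq_intros simp: power2_eq_square field_simps)

lemma continuous_on_std_normal_density [continuous_intros]:
  "continuous_on A f \<Longrightarrow> continuous_on A (\<lambda>x. \<phi> (f x))"
  unfolding std_normal_density_def by (intro continuous_intros) auto

lemma std_normal_density_tendsto_0:
  "(\<phi> \<longlongrightarrow> 0) at_bot" "(\<phi> \<longlongrightarrow> 0) at_top"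
  "((\<lambda>t. t * \<phi> t) \<longlongrightarrow> 0) at_bot" "((\<lambda>t. t * \<phi> t) \<longlongrightarrow> 0) at_top"
  unfolding std_normal_density_def by real_asymp+

lemma integrable_std_normal_basic:
  "integrable lborel \<phi>" "integrable lborel (\<lambda>t. t * \<phi> t)" "integrable lborel (\<lambda>t. t\<^sup>2 * \<phi> t)"
  using integrable_std_normal_moment[of 0] integrable_std_normal_moment[of 1] integrable_std_normal_moment[of 2]
  by (simp_all add: mult.commute)

lemma integrable_std_normal_square_shift: "integrable lborel (\<lambda>t. (t - x)\<^sup>2 * \<phi> t)"
proof -
  have "(\<lambda>t. (t - x)\<^sup>2 * \<phi> t) = (\<lambda>t. t\<^sup>2 * \<phi> t - (2 * x) * (t * \<phi> t) + x\<^sup>2 * \<phi> t)"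
    by (auto simp: power2_diff algebra_simps)
  then show ?thesis using integrable_std_normal_basic by simp
qed

lemma integrable_std_normal_bounded:
  assumes "\<And>x. \<bar>h x\<bar> \<le> B" "continuous_on UNIV h"
  shows "integrable lborel (\<lambda>t. h t * \<phi> t)"
proof (rule integrable_real_dominated)
  have [measurable]: "h \<in> borel_measurable borel"
    using assms(2) by (rule borel_measurable_continuous_onI)
  show "integrable lborel (\<lambda>t. B * \<phi> t)" using integrable_std_normal_basic by simp
  show "(\<lambda>t. h t * \<phi> t) \<in> borel_measurable lborel" by measurable
  show "\<bar>h t * \<phi> t\<bar> \<le> B * \<phi> t" for t
    using assms(1)[of t] by (simp add: abs_mult mult_right_mono)
qed

text \<open>Both sides of these Mills ratio bounds differ by a truncated second moment of
  \<open>N - x\<close>.\<close>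

lemma std_normal_mills_upper:
  "x * \<phi> x \<le> (1 + x\<^sup>2) * (LINT t:{x<..}|lborel. \<phi> t)"
proof -
  have i: "integrable lborel (\<lambda>t. (t - x)\<^sup>2 * \<phi> t)"
    by (rule integrable_std_normal_square_shift)
  \<comment> \<open>Differentiating \<open>- (t - 2 * x) * \<phi> t\<close> brings out the factor
    \<open>t\<^sup>2 - 2 * x * t - 1\<close>, which equals
    \<open>(t - x)\<^sup>2 - (1 + x\<^sup>2)\<close>.\<close>
  have "(LINT t:{x<..}|lborel. ((t - x)\<^sup>2 * \<phi> t - (1 + x\<^sup>2) * \<phi> t)) = 0 - (- (x - 2 * x) * \<phi> x)"
  proof (rule lborel_integral_half_line_FTC(2)[where G = "\<lambda>t. - (t - 2 * x) * \<phi> t"])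
    show "((\<lambda>t. - (t - 2 * x) * \<phi> t) has_real_derivative (t - x)\<^sup>2 * \<phi> t - (1 + x\<^sup>2) * \<phi> t) (at t)" for t
      by (auto intro!: derivative_eq_intros simp: power2_eq_square algebra_simps)
    have "((\<lambda>t. - (t * \<phi> t) + 2 * x * \<phi> t) \<longlongrightarrow> - 0 + 2 * x * 0) at_top"
      by (intro tendsto_intros std_normal_density_tendsto_0)
    then show "((\<lambda>t. - (t - 2 * x) * \<phi> t) \<longlongrightarrow> 0) at_top" by (simp add: algebra_simps)
  qed (use i integrable_std_normal_basic in \<open>auto intro!: continuous_intros\<close>)
  also have "(LINT t:{x<..}|lborel. ((t - x)\<^sup>2 * \<phi> t - (1 + x\<^sup>2) * \<phi> t))
      = (LINT t:{x<..}|lborel. (t - x)\<^sup>2 * \<phi> t) - (1 + x\<^sup>2) * (LINT t:{x<..}|lborel. \<phi> t)"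
    using i integrable_std_normal_basic(1)
    by (subst set_integral_diff(2)) (auto intro!: set_integrable_lborelI)
  finally have "(LINT t:{x<..}|lborel. (t - x)\<^sup>2 * \<phi> t) = (1 + x\<^sup>2) * (LINT t:{x<..}|lborel. \<phi> t) - x * \<phi> x"
    by simp
  moreover have "0 \<le> (LINT t:{x<..}|lborel. (t - x)\<^sup>2 * \<phi> t)"
    unfolding set_lebesgue_integral_def by (intro Bochner_Integration.integral_nonneg) simp
  ultimately show ?thesis by simp
qed

lemma std_normal_mills_lower:
  "- x * \<phi> x \<le> (1 + x\<^sup>2) * (LINT t:{..<x}|lborel. \<phi> t)"
proof -
  have i: "integrable lborel (\<lambda>t. (t - x)\<^sup>2 * \<phi> t)"
    by (rule integrable_std_normal_square_shift)
  have "(LINT t:{..<x}|lborel. ((t - x)\<^sup>2 * \<phi> t - (1 + x\<^sup>2) * \<phi> t)) = - (x - 2 * x) * \<phi> x - 0"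
  proof (rule lborel_integral_half_line_FTC(1)[where G = "\<lambda>t. - (t - 2 * x) * \<phi> t"])
    show "((\<lambda>t. - (t - 2 * x) * \<phi> t) has_real_derivative (t - x)\<^sup>2 * \<phi> t - (1 + x\<^sup>2) * \<phi> t) (at t)" for t
      by (auto intro!: derivative_eq_intros simp: power2_eq_square algebra_simps)
    have "((\<lambda>t. - (t * \<phi> t) + 2 * x * \<phi> t) \<longlongrightarrow> - 0 + 2 * x * 0) at_bot"
      by (intro tendsto_intros std_normal_density_tendsto_0)
    then show "((\<lambda>t. - (t - 2 * x) * \<phi> t) \<longlongrightarrow> 0) at_bot" by (simp add: algebra_simps)
  qed (use i integrable_std_normal_basic in \<open>auto intro!: continuous_intros\<close>)
  also have "(LINT t:{..<x}|lborel. ((t - x)\<^sup>2 * \<phi> t - (1 + x\<^sup>2) * \<phi> t))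
      = (LINT t:{..<x}|lborel. (t - x)\<^sup>2 * \<phi> t) - (1 + x\<^sup>2) * (LINT t:{..<x}|lborel. \<phi> t)"
    using i integrable_std_normal_basic(1)
    by (subst set_integral_diff(2)) (auto intro!: set_integrable_lborelI)
  finally have "(LINT t:{..<x}|lborel. (t - x)\<^sup>2 * \<phi> t) = (1 + x\<^sup>2) * (LINT t:{..<x}|lborel. \<phi> t) + x * \<phi> x"
    by simp
  moreover have "0 \<le> (LINT t:{..<x}|lborel. (t - x)\<^sup>2 * \<phi> t)"
    unfolding set_lebesgue_integral_def by (intro Bochner_Integration.integral_nonneg) simp
  ultimately show ?thesis by simp
qed

text \<open>Divided by \<open>\<phi> x\<close>, the left side is the derivative of \<open>x\<close>
  times the Stein solution of \<open>k\<close>. Monotonicity compares a tail integral of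
  \<open>k\<close> with \<open>k x\<close> times the normal tail, and a Mills bound finishes: the
  upper tail is used if \<open>k x\<close> is nonnegative (mean zero converts it to the lower one),
  the lower tail otherwise.\<close>

lemma stein_increasing_le:
  fixes k :: "real \<Rightarrow> real"
  assumes mono: "mono k" and int: "integrable lborel (\<lambda>t. k t * \<phi> t)"
    and mean: "(\<integral>t. k t * \<phi> t \<partial>lborel) = 0"
  shows "(1 + x\<^sup>2) * (LINT t:{..<x}|lborel. k t * \<phi> t) + x * \<phi> x * k x \<le> 0"
proof (cases "0 \<le> k x")
  case True
  have "(LINT t:{x<..}|lborel. k x * \<phi> t) \<le> (LINT t:{x<..}|lborel. k t * \<phi> t)"
    using int integrable_std_normal_basic(1) monoD[OF mono]
    by (intro set_integral_mono set_integrable_lborelI) (auto intro!: mult_right_mono)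
  then have 1: "k x * (LINT t:{x<..}|lborel. \<phi> t) \<le> - (LINT t:{..<x}|lborel. k t * \<phi> t)"
    using lborel_integral_split_at[OF int, of x] mean by simp
  have "x * \<phi> x * k x \<le> (1 + x\<^sup>2) * (LINT t:{x<..}|lborel. \<phi> t) * k x"
    using std_normal_mills_upper True by (intro mult_right_mono) auto
  also have "\<dots> = (1 + x\<^sup>2) * (k x * (LINT t:{x<..}|lborel. \<phi> t))" by simp
  also have "\<dots> \<le> (1 + x\<^sup>2) * - (LINT t:{..<x}|lborel. k t * \<phi> t)"
    using 1 by (intro mult_left_mono) auto
  finally show ?thesis by simp
next
  case False
  have "(LINT t:{..<x}|lborel. k t * \<phi> t) \<le> (LINT t:{..<x}|lborel. k x * \<phi> t)"
    using int integrable_std_normal_basic(1) monoD[OF mono]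
    by (intro set_integral_mono set_integrable_lborelI) (auto intro!: mult_right_mono)
  then have 1: "(LINT t:{..<x}|lborel. k t * \<phi> t) \<le> k x * (LINT t:{..<x}|lborel. \<phi> t)" by simp
  have "(1 + x\<^sup>2) * (LINT t:{..<x}|lborel. k t * \<phi> t) \<le> (1 + x\<^sup>2) * (k x * (LINT t:{..<x}|lborel. \<phi> t))"
    using 1 by (intro mult_left_mono) auto
  also have "\<dots> = k x * ((1 + x\<^sup>2) * (LINT t:{..<x}|lborel. \<phi> t))" by simp
  also have "\<dots> \<le> k x * (- x * \<phi> x)"
    using std_normal_mills_lower False by (intro mult_left_mono_neg) auto
  finally show ?thesis by (simp add: algebra_simps)
qed

text \<open>The solution is the integral of \<open>(h - c) * \<phi>\<close> up to \<open>x\<close>,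
  divided by \<open>\<phi> x\<close>, with \<open>c\<close> the normal mean of \<open>h\<close>.
  Since \<open>f' x = x * f x + (h x - c)\<close>, the constant 2 splits into 1 for
  \<open>x * f x\<close> and 1 for \<open>h\<close>.\<close>

lemma stein_solution_exists:
  fixes h :: "real \<Rightarrow> real"
  assumes B: "\<And>x. \<bar>h x\<bar> \<le> B" and lip: "\<And>x y. \<bar>h x - h y\<bar> \<le> \<bar>x - y\<bar>"
  obtains f f' C where "\<And>x. (f has_real_derivative f' x) (at x)"
    and "\<And>x. \<bar>f x\<bar> \<le> C" "\<And>x. \<bar>f' x\<bar> \<le> C"
    and "\<And>x y. \<bar>f' x - f' y\<bar> \<le> 2 * \<bar>x - y\<bar>"
    and "\<And>x. f' x - x * f x = h x - (\<integral>t. h t * \<phi> t \<partial>lborel)"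
proof -
  define c where "c = (\<integral>t. h t * \<phi> t \<partial>lborel)"
  have ch: "continuous_on UNIV h"
    by (rule lipschitz_on_continuous_on[of 1]) (auto intro!: lipschitz_onI simp: dist_real_def lip)
  have ih: "integrable lborel (\<lambda>t. h t * \<phi> t)"
    by (rule integrable_std_normal_bounded[OF B ch])
  have I1: "(\<integral>t. \<phi> t \<partial>lborel) = 1" using integral_std_normal_moment_even[of 0] by simp
  have I0: "(\<integral>t. t * \<phi> t \<partial>lborel) = 0" using integral_std_normal_moment_odd[of 0] by (simp add: mult.commute)
  have c: "\<bar>c\<bar> \<le> B"
  proof -
    have "\<bar>c\<bar> \<le> (\<integral>t. \<bar>h t * \<phi> t\<bar> \<partial>lborel)" unfolding c_def by (rule integral_abs_bound)
    also have "\<dots> \<le> (\<integral>t. B * \<phi> t \<partial>lborel)"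
    proof (rule integral_mono)
      show "\<bar>h t * \<phi> t\<bar> \<le> B * \<phi> t" for t
        using B[of t] by (simp add: abs_mult mult_right_mono)
    qed (use ih integrable_std_normal_basic(1) in \<open>simp_all only: integrable_abs integrable_mult_right\<close>)
    finally show ?thesis using I1 by simp
  qed
  define g where "g = (\<lambda>t. (h t - c) * \<phi> t)"
  have ig: "integrable lborel g" unfolding g_def left_diff_distrib using ih integrable_std_normal_basic by simp
  have cg: "continuous_on UNIV g" unfolding g_def using ch by (intro continuous_intros)
  have Ig: "(\<integral>t. g t \<partial>lborel) = 0" unfolding g_def left_diff_distrib
    using ih integrable_std_normal_basic I1 by (simp add: c_def)
  define a where "a = (\<lambda>x. LINT t:{..<x}|lborel. g t)"
  have Da: "(a has_real_derivative g x) (at x)" for x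
    unfolding a_def by (rule has_real_derivative_lower_integral[OF ig cg])
  define f where "f = (\<lambda>x. a x / \<phi> x)"
  define f' where "f' = (\<lambda>x. x * f x + (h x - c))"
  have pnz: "\<phi> x \<noteq> 0" for x using std_normal_density_pos[of x] by linarith
  have Df: "(f has_real_derivative f' x) (at x)" for x
    unfolding f_def f'_def g_def using pnz[of x]
    by (auto intro!: derivative_eq_intros Da simp: g_def field_simps power2_eq_square)
  \<comment> \<open>This is the numerator of the Stein solution of the identity, which is therefore
    the constant -1.\<close>
  have neg\<phi>: "(LINT t:{..<x}|lborel. t * \<phi> t) = - \<phi> x - - 0" for x
    by (rule lborel_integral_half_line_FTC(1)[where G = "\<lambda>x. - \<phi> x"])
      (use integrable_std_normal_basic in \<open>auto intro!: continuous_intros derivative_eq_intros tendsto_minus[OF std_normal_density_tendsto_0(1), simplified]\<close>)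
  \<comment> \<open>The identity plus or minus \<open>h - c\<close> is increasing because
    \<open>h\<close> is 1-Lipschitz, and it is centered under the normal law.\<close>
  have U: "(1 + x\<^sup>2) * (\<epsilon> * a x - \<phi> x) + x * \<phi> x * (x + \<epsilon> * (h x - c)) \<le> 0" if e: "\<epsilon> = 1 \<or> \<epsilon> = - 1" for x \<epsilon> :: real
  proof -
    define k where "k = (\<lambda>t. t + \<epsilon> * (h t - c))"
    have k\<phi>: "k t * \<phi> t = t * \<phi> t + \<epsilon> * g t" for t unfolding k_def g_def by (simp add: algebra_simps)
    have "mono k"
    proof (rule monoI)
      fix s t :: real assume "s \<le> t"
      then show "k s \<le> k t" using lip[of s t] e unfolding k_def by auto
    qed
    moreover have "integrable lborel (\<lambda>t. k t * \<phi> t)" unfolding k\<phi> using ig integrable_std_normal_basic by simp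
    moreover have "(\<integral>t. k t * \<phi> t \<partial>lborel) = 0" unfolding k\<phi> using ig integrable_std_normal_basic I0 Ig by simp
    ultimately have "(1 + x\<^sup>2) * (LINT t:{..<x}|lborel. k t * \<phi> t) + x * \<phi> x * k x \<le> 0"
      by (rule stein_increasing_le)
    moreover have "(LINT t:{..<x}|lborel. k t * \<phi> t) = \<epsilon> * a x - \<phi> x"
      unfolding k\<phi> using ig integrable_std_normal_basic neg\<phi>[of x]
      by (subst set_integral_add(2)) (auto intro!: set_integrable_lborelI simp: a_def)
    ultimately show ?thesis by (simp add: k_def)
  qed
  \<comment> \<open>The bounded quantity is the derivative of \<open>x * f x\<close>. In
    \<open>U\<close> the identity part leaves just \<open>- \<phi> x\<close>, so the two signs of
    \<epsilon> bound it from both sides.\<close>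
  have V: "\<bar>(1 + x\<^sup>2) * f x + x * (h x - c)\<bar> \<le> 1" for x
  proof -
    define V where "V = (1 + x\<^sup>2) * f x + x * (h x - c)"
    have ax: "a x = f x * \<phi> x" unfolding f_def using pnz[of x] by simp
    have "\<phi> x * V \<le> \<phi> x * 1" "\<phi> x * (- V) \<le> \<phi> x * 1"
      using U[of 1 x] U[of "-1" x] unfolding V_def ax by (simp_all add: algebra_simps power2_eq_square)
    then have "V \<le> 1" "- V \<le> 1" using std_normal_density_pos[of x] by (simp_all only: mult_le_cancel_left_pos)
    then show ?thesis unfolding V_def by simp
  qed
  \<comment> \<open>Dividing \<open>V\<close> by \<open>1 + x\<^sup>2\<close> bounds
    \<open>f\<close> and \<open>x * f x\<close> by \<open>1 + 2 * B\<close>; the summand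
    \<open>h - c\<close> of \<open>f'\<close> adds another \<open>2 * B\<close>.\<close>
  define C where "C = 1 + 4 * B"
  have hc: "\<bar>h x - c\<bar> \<le> 2 * B" for x using B[of x] c by linarith
  have B0: "0 \<le> B" using B[of 0] by linarith
  have fb: "(1 + x\<^sup>2) * \<bar>f x\<bar> \<le> 1 + 2 * B * \<bar>x\<bar>" for x
  proof -
    have "\<bar>x * (h x - c)\<bar> \<le> \<bar>x\<bar> * (2 * B)" unfolding abs_mult using hc by (intro mult_left_mono) auto
    then have "\<bar>(1 + x\<^sup>2) * f x\<bar> \<le> 1 + \<bar>x\<bar> * (2 * B)" using V[of x] by linarith
    then show ?thesis by (simp add: abs_mult mult_ac)
  qed
  have q: "\<bar>x\<bar> \<le> 1 + x\<^sup>2" for x :: real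
    using sum_squares_bound[of 1 "\<bar>x\<bar>"] by simp
  have f1: "\<bar>f x\<bar> \<le> 1 + 2 * B" for x
  proof -
    have "2 * B * \<bar>x\<bar> \<le> 2 * B * (1 + x\<^sup>2)" using q[of x] B0 by (intro mult_left_mono) auto
    moreover have "1 \<le> 1 + x\<^sup>2" by simp
    ultimately have "(1 + x\<^sup>2) * \<bar>f x\<bar> \<le> (1 + x\<^sup>2) + 2 * B * (1 + x\<^sup>2)"
      using fb[of x] by linarith
    then have "(1 + x\<^sup>2) * \<bar>f x\<bar> \<le> (1 + x\<^sup>2) * (1 + 2 * B)" by (simp add: algebra_simps)
    moreover have "0 < 1 + x\<^sup>2" by (smt (verit) zero_le_power2)
    ultimately show ?thesis by (simp only: mult_le_cancel_left_pos)
  qed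
  have xf: "\<bar>x * f x\<bar> \<le> 1 + 2 * B" for x
  proof -
    have "\<bar>x\<bar> * ((1 + x\<^sup>2) * \<bar>f x\<bar>) \<le> \<bar>x\<bar> * (1 + 2 * B * \<bar>x\<bar>)" by (intro mult_left_mono fb) auto
    also have "\<dots> = \<bar>x\<bar> + 2 * B * x\<^sup>2" by (simp add: algebra_simps power2_eq_square)
    also have "\<dots> \<le> (1 + x\<^sup>2) + 2 * B * (1 + x\<^sup>2)"
      using q[of x] B0 by (intro add_mono mult_left_mono) auto
    finally have "(1 + x\<^sup>2) * \<bar>x * f x\<bar> \<le> (1 + x\<^sup>2) * (1 + 2 * B)"
      by (simp add: abs_mult algebra_simps)
    moreover have "0 < 1 + x\<^sup>2" by (smt (verit) zero_le_power2)
    ultimately show ?thesis by (simp only: mult_le_cancel_left_pos)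
  qed
  show ?thesis
  proof
    show "(f has_real_derivative f' x) (at x)" for x by (rule Df)
    show "\<bar>f x\<bar> \<le> C" for x using f1[of x] B0 unfolding C_def by linarith
    show "\<bar>f' x\<bar> \<le> C" for x using xf[of x] hc[of x] unfolding C_def f'_def by linarith
    show "\<bar>f' x - f' y\<bar> \<le> 2 * \<bar>x - y\<bar>" for x y
    proof -
      have "((\<lambda>x. x * f x) has_real_derivative (1 + x\<^sup>2) * f x + x * (h x - c)) (at x)" for x
        by (auto intro!: derivative_eq_intros Df simp: f'_def power2_eq_square algebra_simps)
      then have "\<bar>x * f x - y * f y\<bar> \<le> 1 * \<bar>x - y\<bar>"
        using field_differentiable_bound[of UNIV "\<lambda>x. x * f x" "\<lambda>x. (1 + x\<^sup>2) * f x + x * (h x - c)" 1 x y] V by auto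
      then have "\<bar>(x * f x - y * f y) + (h x - h y)\<bar> \<le> 1 * \<bar>x - y\<bar> + \<bar>x - y\<bar>"
        by (intro order_trans[OF abs_triangle_ineq add_mono] lip)
      then show ?thesis unfolding f'_def by (simp add: algebra_simps)
    qed
    show "f' x - x * f x = h x - (\<integral>t. h t * \<phi> t \<partial>lborel)" for x
      unfolding f'_def c_def by simp
  qed
qed

section \<open>Interpolation between a law and the normal law\<close>

text \<open>The difference quotients along any null sequence converge pointwise. Because
  \<open>w\<close> bounds the derivative for all parameters, the mean value inequality makes it a
  dominating function for them.\<close>

lemma has_real_derivative_lebesgue_integral:
  fixes f f' :: "real \<Rightarrow> 'a \<Rightarrow> real"
  assumes int: "\<And>t. integrable M (f t)"
    and der: "\<And>t \<omega>. ((\<lambda>t. f t \<omega>) has_real_derivative f' t \<omega>) (at t)"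
    and meas: "f' t \<in> borel_measurable M"
    and bound: "\<And>t \<omega>. \<bar>f' t \<omega>\<bar> \<le> w \<omega>" and w: "integrable M w"
  shows "((\<lambda>t. \<integral>\<omega>. f t \<omega> \<partial>M) has_real_derivative (\<integral>\<omega>. f' t \<omega> \<partial>M)) (at t)"
  unfolding DERIV_def tendsto_at_iff_sequentially
proof (intro allI impI)
  fix X :: "nat \<Rightarrow> real"
  assume X: "\<forall>i. X i \<in> UNIV - {0}" and X0: "X \<longlonglongrightarrow> 0"
  have "(\<lambda>i. \<integral>\<omega>. (f (t + X i) \<omega> - f t \<omega>) / X i \<partial>M) \<longlonglongrightarrow> (\<integral>\<omega>. f' t \<omega> \<partial>M)"
  proof (rule integral_dominated_convergence)
    show "f' t \<in> borel_measurable M" by (rule meas)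
    show "(\<lambda>\<omega>. (f (t + X i) \<omega> - f t \<omega>) / X i) \<in> borel_measurable M" for i
      using int by measurable
    show "integrable M w" by (rule w)
    show "AE \<omega> in M. (\<lambda>i. (f (t + X i) \<omega> - f t \<omega>) / X i) \<longlonglongrightarrow> f' t \<omega>"
    proof (rule AE_I2)
      fix \<omega>
      have "((\<lambda>h. (f (t + h) \<omega> - f t \<omega>) / h) \<longlongrightarrow> f' t \<omega>) (at 0)"
        using der[of \<omega> t] by (simp add: DERIV_def)
      then show "(\<lambda>i. (f (t + X i) \<omega> - f t \<omega>) / X i) \<longlonglongrightarrow> f' t \<omega>"
        using X X0 unfolding tendsto_at_iff_sequentially comp_def by blast
    qed
    show "AE \<omega> in M. norm ((f (t + X i) \<omega> - f t \<omega>) / X i) \<le> w \<omega>" for i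
    proof (rule AE_I2)
      fix \<omega>
      have "\<bar>f (t + X i) \<omega> - f t \<omega>\<bar> \<le> w \<omega> * \<bar>(t + X i) - t\<bar>"
        using field_differentiable_bound[of UNIV "\<lambda>t. f t \<omega>" "\<lambda>t. f' t \<omega>" "w \<omega>" "t + X i" t] der bound by simp
      moreover have "X i \<noteq> 0" using X by simp
      ultimately show "norm ((f (t + X i) \<omega> - f t \<omega>) / X i) \<le> w \<omega>"
        by (simp add: abs_divide divide_le_eq)
    qed
  qed
  then show "((\<lambda>h. ((\<integral>\<omega>. f (t + h) \<omega> \<partial>M) - (\<integral>\<omega>. f t \<omega> \<partial>M)) / h) \<circ> X) \<longlonglongrightarrow> (\<integral>\<omega>. f' t \<omega> \<partial>M)"
    using int by (simp add: comp_def)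
qed

lemma distr_pair_snd:
  assumes "prob_space M" "sigma_finite_measure N"
  shows "distr (M \<Otimes>\<^sub>M N) N snd = N"
proof (rule measure_eqI)
  interpret M: prob_space M by fact
  interpret N: sigma_finite_measure N by fact
  fix A assume "A \<in> sets (distr (M \<Otimes>\<^sub>M N) N snd)"
  then have A: "A \<in> sets N" by simp
  then have "snd -` A \<inter> space (M \<Otimes>\<^sub>M N) = space M \<times> A"
    using sets.sets_into_space[OF A] by (auto simp: space_pair_measure)
  then show "emeasure (distr (M \<Otimes>\<^sub>M N) N snd) A = emeasure N A"
    using A by (simp add: emeasure_distr N.emeasure_pair_measure_Times M.emeasure_space_1)
qed simp

section \<open>Gaussian integrals and the interpolation inequality\<close>

abbreviation (input) \<nu> :: "real measure" where "\<nu> \<equiv> std_normal_distribution"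

lemma prob_space_std_normal: "prob_space \<nu>"
  by (rule prob_space_normal_density) simp

lemma integral_std_normal:
  fixes f :: "real \<Rightarrow> real"
  assumes "f \<in> borel_measurable borel"
  shows "(\<integral>x. f x \<partial>\<nu>) = (\<integral>x. f x * \<phi> x \<partial>lborel)"
  using assms by (subst integral_density) (simp_all add: mult.commute)

lemma integrable_std_normal:
  fixes f :: "real \<Rightarrow> real"
  assumes "f \<in> borel_measurable borel"
  shows "integrable \<nu> f \<longleftrightarrow> integrable lborel (\<lambda>x. f x * \<phi> x)"
  using assms by (subst integrable_density) (simp_all add: mult.commute)

lemma integrable_std_normal_id: "integrable \<nu> (\<lambda>y. y)"
  using integrable_std_normal_basic by (subst integrable_std_normal) simp_all

lemma std_normal_abs_moment: "(\<integral>y. \<bar>y\<bar> \<partial>\<nu>) = sqrt (2 / pi)"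
  using integral_std_normal_moment_abs_odd[of 0] by (subst integral_std_normal) (simp_all add: mult.commute)

text \<open>The function \<open>- (g * \<phi>)\<close> vanishes at both infinities, and its
  derivative \<open>y * g y * \<phi> y - g' y * \<phi> y\<close> therefore integrates to
  zero.\<close>

lemma std_normal_integration_by_parts:
  fixes g g' :: "real \<Rightarrow> real"
  assumes g: "\<And>x. (g has_real_derivative g' x) (at x)"
    and b: "\<And>x. \<bar>g x\<bar> \<le> B" and b': "\<And>x. \<bar>g' x\<bar> \<le> B'" and c': "continuous_on UNIV g'"
  shows "(\<integral>y. y * g y \<partial>\<nu>) = (\<integral>y. g' y \<partial>\<nu>)"
proof -
  have c: "continuous_on UNIV g"
    using g by (meson DERIV_isCont continuous_at_imp_continuous_on)
  have [measurable]: "g \<in> borel_measurable borel" "g' \<in> borel_measurable borel"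
    using c c' by (auto intro: borel_measurable_continuous_onI)
  have i': "integrable lborel (\<lambda>y. g' y * \<phi> y)" by (rule integrable_std_normal_bounded[OF b' c'])
  have i: "integrable lborel (\<lambda>y. y * g y * \<phi> y)"
  proof (rule integrable_real_dominated)
    show "integrable lborel (\<lambda>y. B * \<bar>y * \<phi> y\<bar>)" using integrable_std_normal_basic by simp
    show "\<bar>y * g y * \<phi> y\<bar> \<le> B * \<bar>y * \<phi> y\<bar>" for y
      using mult_right_mono[OF b[of y], of "\<bar>y * \<phi> y\<bar>"] by (simp add: abs_mult mult_ac)
  qed measurable
  have lim: "((\<lambda>y. - (g y * \<phi> y)) \<longlongrightarrow> 0) F" if "(\<phi> \<longlongrightarrow> 0) F" for F
  proof -
    have "((\<lambda>y. g y * \<phi> y) \<longlongrightarrow> 0) F"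
    proof (rule Lim_null_comparison)
      show "\<forall>\<^sub>F y in F. norm (g y * \<phi> y) \<le> B * \<phi> y"
        by (intro always_eventually) (simp add: abs_mult b mult_right_mono)
      show "((\<lambda>y. B * \<phi> y) \<longlongrightarrow> 0) F" using tendsto_mult_right_zero[OF that] .
    qed
    then show ?thesis using tendsto_minus by force
  qed
  have "(\<integral>y. y * g y * \<phi> y - g' y * \<phi> y \<partial>lborel) = 0 - 0"
  proof (rule lborel_integral_FTC[where G = "\<lambda>y. - (g y * \<phi> y)"])
    show "((\<lambda>y. - (g y * \<phi> y)) has_real_derivative y * g y * \<phi> y - g' y * \<phi> y) (at y)" for y
      by (auto intro!: derivative_eq_intros g simp: algebra_simps)
    show "continuous_on UNIV (\<lambda>y. y * g y * \<phi> y - g' y * \<phi> y)"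
      using c c' by (intro continuous_intros)
  qed (use i i' in \<open>auto intro: lim std_normal_density_tendsto_0\<close>)
  then show ?thesis using i i' by (simp add: integral_std_normal mult.assoc)
qed

text \<open>The interpolation argument shared by the second and third distances: \<Lambda> bounds
  the effect of replacing \<mu> by \<kappa> at angle \<theta>, and \<Gamma> is the antiderivative of
  the resulting derivative bound. The bound \<Lambda> is asked for on the open interval only, since
  in one application it grows like the tangent; continuity of \<Gamma> covers the endpoints.\<close>

lemma gaussian_interpolation_le:
  fixes \<mu> \<kappa> :: "real measure" and h h' h'' \<Lambda> \<Gamma> :: "real \<Rightarrow> real" and C :: real
  assumes "prob_space \<mu>" and [measurable_cong]: "sets \<mu> = sets borel" and i1: "integrable \<mu> (\<lambda>x. x)"
    and "prob_space \<kappa>" and [measurable_cong]: "sets \<kappa> = sets borel"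
    and bias: "\<And>K K' C. (\<And>x. (K has_real_derivative K' x) (at x)) \<Longrightarrow> (\<And>x. \<bar>K x\<bar> \<le> C) \<Longrightarrow>
      (\<And>x. \<bar>K' x\<bar> \<le> C) \<Longrightarrow> K' \<in> borel_measurable borel \<Longrightarrow> (\<integral>x. x * K x \<partial>\<mu>) = (\<integral>x. K' x \<partial>\<kappa>)"
    and h: "\<And>x. (h has_real_derivative h' x) (at x)" and h': "\<And>x. (h' has_real_derivative h'' x) (at x)"
    and c'': "continuous_on UNIV h''"
    and bd: "\<And>x. \<bar>h x\<bar> \<le> C" "\<And>x. \<bar>h' x\<bar> \<le> C" "\<And>x. \<bar>h'' x\<bar> \<le> C"
    and \<Lambda>: "\<And>\<theta>. 0 < \<theta> \<Longrightarrow> \<theta> < pi / 2 \<Longrightarrow>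
      \<bar>(\<integral>x. (\<integral>y. h'' (sin \<theta> * x + cos \<theta> * y) \<partial>\<nu>) \<partial>\<mu>) - (\<integral>x. (\<integral>y. h'' (sin \<theta> * x + cos \<theta> * y) \<partial>\<nu>) \<partial>\<kappa>)\<bar> \<le> \<Lambda> \<theta>"
    and \<Gamma>: "\<And>\<theta>. 0 < \<theta> \<Longrightarrow> \<theta> < pi / 2 \<Longrightarrow> (\<Gamma> has_real_derivative sin \<theta> * cos \<theta> * \<Lambda> \<theta>) (at \<theta>)"
    and c\<Gamma>: "continuous_on {0..pi / 2} \<Gamma>"
  shows "\<bar>(\<integral>x. h x \<partial>\<mu>) - (\<integral>x. h x \<partial>\<nu>)\<bar> \<le> \<Gamma> (pi / 2) - \<Gamma> 0"
proof -
  interpret \<mu>: prob_space \<mu> by fact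
  interpret \<kappa>: prob_space \<kappa> by fact
  interpret \<nu>: prob_space \<nu> by (rule prob_space_std_normal)
  interpret P: pair_prob_space \<mu> \<nu> ..
  have ch: "continuous_on UNIV h" and ch': "continuous_on UNIV h'"
    using h h' by (meson DERIV_isCont continuous_at_imp_continuous_on)+
  have [measurable]: "h \<in> borel_measurable borel" "h' \<in> borel_measurable borel" "h'' \<in> borel_measurable borel"
    using ch ch' c'' by (auto intro: borel_measurable_continuous_onI)
  have C0: "0 \<le> C" using bd(1)[of 0] by linarith
  have iy: "integrable \<nu> (\<lambda>y. y)" by (rule integrable_std_normal_id)
  have ipx: "integrable (\<mu> \<Otimes>\<^sub>M \<nu>) (\<lambda>p. fst p)"
    using i1 integrable_distr[of fst "\<mu> \<Otimes>\<^sub>M \<nu>" \<mu> "\<lambda>x. x"] by (simp add: \<nu>.distr_pair_fst)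
  have ipy: "integrable (\<mu> \<Otimes>\<^sub>M \<nu>) (\<lambda>p. snd p)"
    using iy integrable_distr[of snd "\<mu> \<Otimes>\<^sub>M \<nu>" \<nu> "\<lambda>x. x"] by (simp add: distr_pair_snd[OF \<mu>.prob_space_axioms \<nu>.sigma_finite_measure_axioms])
  \<comment> \<open>The path starts in \<nu> at angle 0 and ends in \<mu> at \<open>pi / 2\<close>;
    sine and cosine are the weights of the two independent coordinates.\<close>
  define \<psi> where "\<psi> = (\<lambda>\<theta>. \<integral>p. h (sin \<theta> * fst p + cos \<theta> * snd p) \<partial>(\<mu> \<Otimes>\<^sub>M \<nu>))"
  define d where "d = (\<lambda>\<theta> p. h' (sin \<theta> * fst p + cos \<theta> * snd p) * (cos \<theta> * fst p - sin \<theta> * snd p))"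
  have D\<psi>: "(\<psi> has_real_derivative (\<integral>p. d \<theta> p \<partial>(\<mu> \<Otimes>\<^sub>M \<nu>))) (at \<theta>)" for \<theta>
    unfolding \<psi>_def
  proof (rule has_real_derivative_lebesgue_integral[where w = "\<lambda>p. C * (\<bar>fst p\<bar> + \<bar>snd p\<bar>)"])
    show "integrable (\<mu> \<Otimes>\<^sub>M \<nu>) (\<lambda>p. h (sin t * fst p + cos t * snd p))" for t
      by (rule P.integrable_const_bound[of _ C]) (use bd in auto)
    show "((\<lambda>t. h (sin t * fst p + cos t * snd p)) has_real_derivative d t p) (at t)" for t and p :: "real \<times> real"
      unfolding d_def by (rule DERIV_chain2[OF h]) (auto intro!: derivative_eq_intros simp: mult_ac)
    show "d \<theta> \<in> borel_measurable (\<mu> \<Otimes>\<^sub>M \<nu>)" unfolding d_def by measurable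
    show "integrable (\<mu> \<Otimes>\<^sub>M \<nu>) (\<lambda>p. C * (\<bar>fst p\<bar> + \<bar>snd p\<bar>))" using ipx ipy by simp
    fix t and p :: "real \<times> real"
    have "\<bar>cos t * fst p\<bar> \<le> 1 * \<bar>fst p\<bar>" "\<bar>sin t * snd p\<bar> \<le> 1 * \<bar>snd p\<bar>"
      unfolding abs_mult by (intro mult_right_mono; simp)+
    then have "\<bar>cos t * fst p - sin t * snd p\<bar> \<le> \<bar>fst p\<bar> + \<bar>snd p\<bar>" by linarith
    then show "\<bar>d t p\<bar> \<le> C * (\<bar>fst p\<bar> + \<bar>snd p\<bar>)"
      unfolding d_def abs_mult by (intro mult_mono bd C0) auto
  qed
  have deriv_le: "\<bar>\<integral>p. d \<theta> p \<partial>(\<mu> \<Otimes>\<^sub>M \<nu>)\<bar> \<le> sin \<theta> * cos \<theta> * \<Lambda> \<theta>" if \<theta>: "0 < \<theta>" "\<theta> < pi / 2" for \<theta>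
  proof -
    define s c where "s = sin \<theta>" and "c = cos \<theta>"
    have s: "0 < s" and c: "0 < c" using \<theta> by (auto simp: s_def c_def intro: sin_gt_zero cos_gt_zero)
    define K K2 where "K = (\<lambda>x. \<integral>y. h' (s * x + c * y) \<partial>\<nu>)" and "K2 = (\<lambda>x. \<integral>y. h'' (s * x + c * y) \<partial>\<nu>)"
    have [measurable]: "K2 \<in> borel_measurable borel" unfolding K2_def by measurable
    have DK: "(K has_real_derivative s * K2 x) (at x)" for x
    proof -
      have "((\<lambda>x. \<integral>y. h' (s * x + c * y) \<partial>\<nu>) has_real_derivative (\<integral>y. s * h'' (s * x + c * y) \<partial>\<nu>)) (at x)"
      proof (rule has_real_derivative_lebesgue_integral[where w = "\<lambda>y. s * C"])
        show "integrable \<nu> (\<lambda>y. h' (s * t + c * y))" for t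
          by (rule \<nu>.integrable_const_bound[of _ C]) (use bd in auto)
        show "((\<lambda>t. h' (s * t + c * y)) has_real_derivative s * h'' (s * t + c * y)) (at t)" for t y
          by (rule DERIV_cong[OF DERIV_chain2[OF h']]) (auto intro!: derivative_eq_intros)
        show "\<bar>s * h'' (s * t + c * y)\<bar> \<le> s * C" for t y
          unfolding abs_mult using s bd by (intro mult_mono) auto
      qed simp_all
      then show ?thesis unfolding K_def K2_def by simp
    qed
    have abs_int: "\<bar>\<integral>y. g y \<partial>\<nu>\<bar> \<le> C" if "g \<in> borel_measurable borel" "\<And>y. \<bar>g y\<bar> \<le> C" for g :: "real \<Rightarrow> real"
    proof -
      have i: "integrable \<nu> g" by (rule \<nu>.integrable_const_bound[of _ C]) (use that in auto)
      have "\<bar>\<integral>y. g y \<partial>\<nu>\<bar> \<le> (\<integral>y. \<bar>g y\<bar> \<partial>\<nu>)" by (rule integral_abs_bound)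
      also have "\<dots> \<le> (\<integral>y. C \<partial>\<nu>)" by (rule integral_mono) (use i that in auto)
      finally show ?thesis using \<nu>.prob_space by simp
    qed
    \<comment> \<open>First coordinate: zero biasing trades the factor \<open>x\<close> for the
      derivative of \<open>K\<close> under \<kappa>, which brings out \<open>s\<close>.\<close>
    have "(\<integral>x. x * K x \<partial>\<mu>) = (\<integral>x. s * K2 x \<partial>\<kappa>)"
    proof (rule bias)
      show "(K has_real_derivative s * K2 x) (at x)" for x by (rule DK)
      show "\<bar>K x\<bar> \<le> C" for x unfolding K_def by (rule abs_int) (auto simp: bd)
      have "\<bar>K2 x\<bar> \<le> C" for x unfolding K2_def by (rule abs_int) (auto simp: bd)
      then have "\<bar>s\<bar> * \<bar>K2 x\<bar> \<le> 1 * C" for x by (intro mult_mono) (auto simp: s_def)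
      then show "\<bar>s * K2 x\<bar> \<le> C" for x by (simp add: abs_mult)
    qed measurable
    \<comment> \<open>Second coordinate: Gaussian integration by parts trades the factor
      \<open>y\<close> for \<open>c\<close>. With the weights \<open>c\<close> and
      \<open>- s\<close> from the chain rule, both contributions carry the same factor
      \<open>s * c\<close>.\<close>
    moreover have "(\<integral>y. y * h' (s * x + c * y) \<partial>\<nu>) = c * K2 x" for x
    proof -
      have "(\<integral>y. y * h' (s * x + c * y) \<partial>\<nu>) = (\<integral>y. c * h'' (s * x + c * y) \<partial>\<nu>)"
      proof (rule std_normal_integration_by_parts)
        show "((\<lambda>y. h' (s * x + c * y)) has_real_derivative c * h'' (s * x + c * y)) (at y)" for y
          by (rule DERIV_cong[OF DERIV_chain2[OF h']]) (auto intro!: derivative_eq_intros)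
        show "\<bar>h' (s * x + c * y)\<bar> \<le> C" for y by (rule bd)
        show "\<bar>c * h'' (s * x + c * y)\<bar> \<le> c * C" for y
          unfolding abs_mult using c bd by (intro mult_mono) auto
        show "continuous_on UNIV (\<lambda>y. c * h'' (s * x + c * y))"
          by (intro continuous_intros continuous_on_compose2[OF c'']) auto
      qed
      then show ?thesis unfolding K2_def by simp
    qed
    moreover have ix: "integrable (\<mu> \<Otimes>\<^sub>M \<nu>) (\<lambda>p. fst p * h' (s * fst p + c * snd p))"
    proof (rule integrable_real_dominated)
      show "integrable (\<mu> \<Otimes>\<^sub>M \<nu>) (\<lambda>p. \<bar>fst p\<bar> * C)" using ipx by simp
      show "\<bar>fst p * h' (s * fst p + c * snd p)\<bar> \<le> \<bar>fst p\<bar> * C" for p :: "real \<times> real"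
        unfolding abs_mult by (intro mult_left_mono bd) simp
    qed measurable
    moreover have iy: "integrable (\<mu> \<Otimes>\<^sub>M \<nu>) (\<lambda>p. snd p * h' (s * fst p + c * snd p))"
    proof (rule integrable_real_dominated)
      show "integrable (\<mu> \<Otimes>\<^sub>M \<nu>) (\<lambda>p. \<bar>snd p\<bar> * C)" using ipy by simp
      show "\<bar>snd p * h' (s * fst p + c * snd p)\<bar> \<le> \<bar>snd p\<bar> * C" for p :: "real \<times> real"
        unfolding abs_mult by (intro mult_left_mono bd) simp
    qed measurable
    ultimately have "(\<integral>p. fst p * h' (s * fst p + c * snd p) \<partial>(\<mu> \<Otimes>\<^sub>M \<nu>)) = s * (\<integral>x. K2 x \<partial>\<kappa>)"
      "(\<integral>p. snd p * h' (s * fst p + c * snd p) \<partial>(\<mu> \<Otimes>\<^sub>M \<nu>)) = c * (\<integral>x. K2 x \<partial>\<mu>)"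
      unfolding P.integral_fst'[OF ix, symmetric] P.integral_fst'[OF iy, symmetric] by (simp_all add: K_def)
    moreover have "(\<integral>p. d \<theta> p \<partial>(\<mu> \<Otimes>\<^sub>M \<nu>)) = c * (\<integral>p. fst p * h' (s * fst p + c * snd p) \<partial>(\<mu> \<Otimes>\<^sub>M \<nu>))
        - s * (\<integral>p. snd p * h' (s * fst p + c * snd p) \<partial>(\<mu> \<Otimes>\<^sub>M \<nu>))"
    proof -
      have "d \<theta> = (\<lambda>p. c * (fst p * h' (s * fst p + c * snd p)) - s * (snd p * h' (s * fst p + c * snd p)))"
        unfolding d_def s_def c_def by (auto simp: algebra_simps)
      then show ?thesis using ix iy by simp
    qed
    ultimately have "(\<integral>p. d \<theta> p \<partial>(\<mu> \<Otimes>\<^sub>M \<nu>)) = - (s * c * ((\<integral>x. K2 x \<partial>\<mu>) - (\<integral>x. K2 x \<partial>\<kappa>)))"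
      by (simp add: algebra_simps)
    then have "\<bar>\<integral>p. d \<theta> p \<partial>(\<mu> \<Otimes>\<^sub>M \<nu>)\<bar> = s * c * \<bar>(\<integral>x. K2 x \<partial>\<mu>) - (\<integral>x. K2 x \<partial>\<kappa>)\<bar>"
      using s c by (simp add: abs_mult)
    also have "\<dots> \<le> s * c * \<Lambda> \<theta>"
      using s c \<Lambda>[OF \<theta>] unfolding K2_def s_def c_def by (intro mult_left_mono) auto
    finally show ?thesis unfolding s_def c_def .
  qed
  have "0 \<le> pi / 2" by simp
  have \<psi>0: "\<psi> 0 = (\<integral>x. h x \<partial>\<nu>)"
    using integral_distr[of snd "\<mu> \<Otimes>\<^sub>M \<nu>" \<nu> h] by (simp add: \<psi>_def distr_pair_snd[OF \<mu>.prob_space_axioms \<nu>.sigma_finite_measure_axioms])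
  have \<psi>1: "\<psi> (pi / 2) = (\<integral>x. h x \<partial>\<mu>)"
    using integral_distr[of fst "\<mu> \<Otimes>\<^sub>M \<nu>" \<mu> h] by (simp add: \<psi>_def \<nu>.distr_pair_fst)
  have c\<psi>: "continuous_on A \<psi>" for A
    using D\<psi> by (meson DERIV_isCont continuous_at_imp_continuous_on)
  \<comment> \<open>Both \<open>\<Gamma> - \<psi>\<close> and \<open>\<Gamma> + \<psi>\<close> are
    nondecreasing, so the increment of \<Gamma> bounds that of \<psi> in absolute value.\<close>
  have "\<Gamma> 0 - \<psi> 0 \<le> \<Gamma> (pi / 2) - \<psi> (pi / 2)"
  proof (rule DERIV_nonneg_imp_increasing_open[OF \<open>0 \<le> pi / 2\<close>])
    fix \<theta> :: real assume \<theta>: "0 < \<theta>" "\<theta> < pi / 2"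
    note DERIV_diff[OF \<Gamma>[OF \<theta>] D\<psi>]
    moreover have "0 \<le> sin \<theta> * cos \<theta> * \<Lambda> \<theta> - (\<integral>p. d \<theta> p \<partial>(\<mu> \<Otimes>\<^sub>M \<nu>))"
      using deriv_le[OF \<theta>] by linarith
    ultimately show "\<exists>y. ((\<lambda>\<theta>. \<Gamma> \<theta> - \<psi> \<theta>) has_real_derivative y) (at \<theta>) \<and> 0 \<le> y"
      by blast
  qed (intro continuous_intros c\<Gamma> c\<psi>)
  moreover have "\<Gamma> 0 + \<psi> 0 \<le> \<Gamma> (pi / 2) + \<psi> (pi / 2)"
  proof (rule DERIV_nonneg_imp_increasing_open[OF \<open>0 \<le> pi / 2\<close>])
    fix \<theta> :: real assume \<theta>: "0 < \<theta>" "\<theta> < pi / 2"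
    note DERIV_add[OF \<Gamma>[OF \<theta>] D\<psi>]
    moreover have "0 \<le> sin \<theta> * cos \<theta> * \<Lambda> \<theta> + (\<integral>p. d \<theta> p \<partial>(\<mu> \<Otimes>\<^sub>M \<nu>))"
      using deriv_le[OF \<theta>] by linarith
    ultimately show "\<exists>y. ((\<lambda>\<theta>. \<Gamma> \<theta> + \<psi> \<theta>) has_real_derivative y) (at \<theta>) \<and> 0 \<le> y"
      by blast
  qed (intro continuous_intros c\<Gamma> c\<psi>)
  ultimately show ?thesis unfolding \<psi>0 \<psi>1 by linarith
qed

text \<open>The laws on the real line of a variable and of its zero biased version. Unit variance is
  built into \<open>bias\<close>, which has no variance factor; \<open>z\<close> stands for a bound
  on their first distance, stated for arbitrary Lipschitz constants so that no test function has to
  be rescaled.\<close>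

locale zero_bias_laws =
  fixes \<mu> \<kappa> :: "real measure" and z :: real
  assumes prob_\<mu>: "prob_space \<mu>" and sets_\<mu> [measurable_cong]: "sets \<mu> = sets borel"
    and int_id: "integrable \<mu> (\<lambda>x. x)"
    and prob_\<kappa>: "prob_space \<kappa>" and sets_\<kappa> [measurable_cong]: "sets \<kappa> = sets borel"
    and bias: "\<And>K K' C. (\<And>x. (K has_real_derivative K' x) (at x)) \<Longrightarrow> (\<And>x. \<bar>K x\<bar> \<le> C) \<Longrightarrow>
      (\<And>x. \<bar>K' x\<bar> \<le> C) \<Longrightarrow> K' \<in> borel_measurable borel \<Longrightarrow> (\<integral>x. x * K x \<partial>\<mu>) = (\<integral>x. K' x \<partial>\<kappa>)"
    and lipschitz_le: "\<And>g L C. 0 < L \<Longrightarrow> (\<And>x y. \<bar>g x - g y\<bar> \<le> L * \<bar>x - y\<bar>) \<Longrightarrow> (\<And>x. \<bar>g x\<bar> \<le> C) \<Longrightarrow>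
      \<bar>(\<integral>x. g x \<partial>\<mu>) - (\<integral>x. g x \<partial>\<kappa>)\<bar> \<le> L * z"

lemma continuous_on_lipschitz:
  fixes g :: "real \<Rightarrow> real"
  assumes "\<And>x y. \<bar>g x - g y\<bar> \<le> L * \<bar>x - y\<bar>"
  shows "continuous_on A g"
\<comment> \<open>\<open>lipschitz_on\<close> requires a nonnegative constant, hence the
  maximum.\<close>
proof (rule lipschitz_on_continuous_on[of "max 0 L"])
  have "L * \<bar>x - y\<bar> \<le> max 0 L * \<bar>x - y\<bar>" for x y by (intro mult_right_mono) auto
  then show "(max 0 L)-lipschitz_on A g"
    by (intro lipschitz_onI) (auto simp: dist_real_def intro: order_trans[OF assms])
qed

text \<open>The factor \<open>sqrt (2 / pi)\<close> is the first absolute normal moment. Bounded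
  integrands use \<open>a = 0\<close>; integrands carrying the factor \<open>y\<close> from
  integration by parts use \<open>b = 0\<close>.\<close>

lemma std_normal_expectation_abs_le:
  fixes g :: "real \<Rightarrow> real"
  assumes "g \<in> borel_measurable borel" "\<And>y. \<bar>g y\<bar> \<le> a * \<bar>y\<bar> + b"
  shows "integrable \<nu> g" "\<bar>\<integral>y. g y \<partial>\<nu>\<bar> \<le> a * sqrt (2 / pi) + b"
proof -
  interpret \<nu>: prob_space \<nu> by (rule prob_space_std_normal)
  have w: "integrable \<nu> (\<lambda>y. a * \<bar>y\<bar> + b)" using integrable_std_normal_id by simp
  show i: "integrable \<nu> g"
    by (rule integrable_real_dominated[OF w]) (use assms in simp_all)
  have "\<bar>\<integral>y. g y \<partial>\<nu>\<bar> \<le> (\<integral>y. \<bar>g y\<bar> \<partial>\<nu>)" by (rule integral_abs_bound)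
  also have "\<dots> \<le> (\<integral>y. a * \<bar>y\<bar> + b \<partial>\<nu>)"
    by (rule integral_mono[OF integrable_abs[OF i] w]) (rule assms)
  also have "\<dots> = a * sqrt (2 / pi) + b"
    using integrable_std_normal_id std_normal_abs_moment \<nu>.prob_space by simp
  finally show "\<bar>\<integral>y. g y \<partial>\<nu>\<bar> \<le> a * sqrt (2 / pi) + b" .
qed

section \<open>The three orders of smoothness of the test function\<close>

context zero_bias_laws
begin

text \<open>Integrating the Stein equation over \<mu> and applying \<open>bias\<close> to its
  solution turns the difference into one of \<open>f'\<close> between \<mu> and \<kappa>.\<close>

lemma lipschitz_test_le:
  assumes B: "\<And>x. \<bar>h x\<bar> \<le> B" and lip: "\<And>x y. \<bar>h x - h y\<bar> \<le> \<bar>x - y\<bar>"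
  shows "\<bar>(\<integral>x. h x \<partial>\<mu>) - (\<integral>x. h x \<partial>\<nu>)\<bar> \<le> 2 * z"
proof -
  interpret \<mu>: prob_space \<mu> by (rule prob_\<mu>)
  obtain f f' C where f: "\<And>x. (f has_real_derivative f' x) (at x)"
    and b: "\<And>x. \<bar>f x\<bar> \<le> C" "\<And>x. \<bar>f' x\<bar> \<le> C"
    and l: "\<And>x y. \<bar>f' x - f' y\<bar> \<le> 2 * \<bar>x - y\<bar>"
    and e: "\<And>x. f' x - x * f x = h x - (\<integral>t. h t * \<phi> t \<partial>lborel)"
    using stein_solution_exists[OF B lip] by blast
  have "continuous_on UNIV f"
    using f by (meson DERIV_isCont continuous_at_imp_continuous_on)
  moreover have "continuous_on UNIV h" "continuous_on UNIV f'"
    using continuous_on_lipschitz[of h 1] lip continuous_on_lipschitz[OF l] by auto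
  ultimately have [measurable]: "h \<in> borel_measurable borel" "f' \<in> borel_measurable borel" "f \<in> borel_measurable borel"
    by (auto intro: borel_measurable_continuous_onI)
  have ih: "integrable \<mu> h" by (rule \<mu>.integrable_const_bound[of _ B]) (use B in auto)
  have if': "integrable \<mu> f'" by (rule \<mu>.integrable_const_bound[of _ C]) (use b in auto)
  have ixf: "integrable \<mu> (\<lambda>x. x * f x)"
  proof (rule integrable_real_dominated)
    show "integrable \<mu> (\<lambda>x. \<bar>x\<bar> * C)" using int_id by simp
    show "\<bar>x * f x\<bar> \<le> \<bar>x\<bar> * C" for x unfolding abs_mult by (intro mult_left_mono b) simp
  qed measurable
  have "(\<integral>x. f' x - x * f x \<partial>\<mu>) = (\<integral>x. h x - (\<integral>t. h t \<partial>\<nu>) \<partial>\<mu>)"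
    unfolding e by (subst integral_std_normal) simp_all
  then have "(\<integral>x. f' x \<partial>\<mu>) - (\<integral>x. x * f x \<partial>\<mu>) = (\<integral>x. h x \<partial>\<mu>) - (\<integral>x. h x \<partial>\<nu>)"
    using ih if' ixf by (simp add: \<mu>.prob_space)
  moreover have "(\<integral>x. x * f x \<partial>\<mu>) = (\<integral>x. f' x \<partial>\<kappa>)" by (rule bias[OF f b]) measurable
  moreover have "\<bar>(\<integral>x. f' x \<partial>\<mu>) - (\<integral>x. f' x \<partial>\<kappa>)\<bar> \<le> 2 * z" by (rule lipschitz_le[OF _ l b(2)]) simp
  ultimately show ?thesis by simp
qed

text \<open>No Lipschitz bound on \<open>h''\<close> is available, but one integration by parts
  writes its Gaussian average as an average of \<open>y * h'\<close> divided by \<open>c\<close>.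
  This is Lipschitz with constant \<open>s / c * sqrt (2 / pi)\<close>, as \<open>h'\<close> is
  1-Lipschitz. The weight \<open>s * c\<close> leaves the squared sine, whose integral is
  \<open>pi / 4\<close>.\<close>

lemma second_order_smooth_test_le:
  assumes h: "\<And>x. (h has_real_derivative h' x) (at x)" and h': "\<And>x. (h' has_real_derivative h'' x) (at x)"
    and c'': "continuous_on UNIV h''"
    and bd: "\<And>x. \<bar>h x\<bar> \<le> C" "\<And>x. \<bar>h' x\<bar> \<le> C" and b'': "\<And>x. \<bar>h'' x\<bar> \<le> 1"
  shows "\<bar>(\<integral>x. h x \<partial>\<mu>) - (\<integral>x. h x \<partial>\<nu>)\<bar> \<le> sqrt (2 * pi) / 4 * z"
proof -
  define D where "D = max C 1"
  define \<Lambda> where "\<Lambda> = (\<lambda>\<theta>. sin \<theta> / cos \<theta> * sqrt (2 / pi) * z)"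
  define \<Gamma> where "\<Gamma> = (\<lambda>\<theta>. sqrt (2 / pi) * z * ((\<theta> - sin \<theta> * cos \<theta>) / 2))"
  have [measurable]: "h' \<in> borel_measurable borel" "h'' \<in> borel_measurable borel"
    using c'' h' by (auto intro!: borel_measurable_continuous_onI DERIV_isCont continuous_at_imp_continuous_on)
  have "\<bar>(\<integral>x. h x \<partial>\<mu>) - (\<integral>x. h x \<partial>\<nu>)\<bar> \<le> \<Gamma> (pi / 2) - \<Gamma> 0"
  proof (rule gaussian_interpolation_le[OF prob_\<mu> sets_\<mu> int_id prob_\<kappa> sets_\<kappa> bias h h' c''])
    show "\<bar>h x\<bar> \<le> D" "\<bar>h' x\<bar> \<le> D" "\<bar>h'' x\<bar> \<le> D" for x
      using bd[of x] b''[of x] unfolding D_def by auto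
    show "(\<Gamma> has_real_derivative sin \<theta> * cos \<theta> * \<Lambda> \<theta>) (at \<theta>)" if "0 < \<theta>" "\<theta> < pi / 2" for \<theta>
    proof -
      have c: "cos \<theta> \<noteq> 0" using cos_gt_zero[OF that] by simp
      have "(\<Gamma> has_real_derivative sqrt (2 / pi) * z * ((1 - (cos \<theta> * cos \<theta> - sin \<theta> * sin \<theta>)) / 2)) (at \<theta>)"
        unfolding \<Gamma>_def by (auto intro!: derivative_eq_intros simp: field_simps)
      moreover have "(1 - (cos \<theta> * cos \<theta> - sin \<theta> * sin \<theta>)) / 2 = sin \<theta> * sin \<theta>"
        using sin_cos_squared_add[of \<theta>] by (simp add: power2_eq_square)
      ultimately show ?thesis using c unfolding \<Lambda>_def by (simp add: mult_ac)
    qed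
    show "continuous_on {0..pi / 2} \<Gamma>" unfolding \<Gamma>_def by (auto intro!: continuous_intros)
    fix \<theta> :: real assume \<theta>: "0 < \<theta>" "\<theta> < pi / 2"
    define s c where "s = sin \<theta>" and "c = cos \<theta>"
    have s: "0 < s" and c: "0 < c" using \<theta> by (auto simp: s_def c_def intro: sin_gt_zero cos_gt_zero)
    define K where "K = (\<lambda>x. \<integral>y. h'' (s * x + c * y) \<partial>\<nu>)"
    have K: "K x = (\<integral>y. y * h' (s * x + c * y) \<partial>\<nu>) / c" for x
    proof -
      have "(\<integral>y. y * h' (s * x + c * y) \<partial>\<nu>) = (\<integral>y. c * h'' (s * x + c * y) \<partial>\<nu>)"
      proof (rule std_normal_integration_by_parts)
        show "((\<lambda>y. h' (s * x + c * y)) has_real_derivative c * h'' (s * x + c * y)) (at y)" for y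
          by (rule DERIV_cong[OF DERIV_chain2[OF h']]) (auto intro!: derivative_eq_intros)
        show "\<bar>h' (s * x + c * y)\<bar> \<le> C" for y by (rule bd)
        show "\<bar>c * h'' (s * x + c * y)\<bar> \<le> c * 1" for y
          unfolding abs_mult using c b'' by (intro mult_mono) auto
        show "continuous_on UNIV (\<lambda>y. c * h'' (s * x + c * y))"
          by (intro continuous_intros continuous_on_compose2[OF c'']) auto
      qed
      then show ?thesis using c unfolding K_def by simp
    qed
    have l': "\<bar>h' x - h' y\<bar> \<le> \<bar>x - y\<bar>" for x y
      using field_differentiable_bound[of UNIV h' h'' 1 x y] h' b'' by simp
    have iyh: "integrable \<nu> (\<lambda>y. y * h' (s * x + c * y))" for x
    proof (rule std_normal_expectation_abs_le)
      show "\<bar>y * h' (s * x + c * y)\<bar> \<le> C * \<bar>y\<bar> + 0" for y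
        using mult_left_mono[OF bd(2)[of "s * x + c * y"], of "\<bar>y\<bar>"] by (simp add: abs_mult mult.commute)
    qed measurable
    have "\<bar>(\<integral>x. K x \<partial>\<mu>) - (\<integral>x. K x \<partial>\<kappa>)\<bar> \<le> (s / c * sqrt (2 / pi)) * z"
    proof (rule lipschitz_le)
      show "0 < s / c * sqrt (2 / pi)" using s c by simp
      show "\<bar>K x\<bar> \<le> 0 * sqrt (2 / pi) + 1" for x
        unfolding K_def by (rule std_normal_expectation_abs_le) (auto simp: b'')
      show "\<bar>K x - K x'\<bar> \<le> s / c * sqrt (2 / pi) * \<bar>x - x'\<bar>" for x x'
      proof -
        have "\<bar>\<integral>y. y * h' (s * x + c * y) - y * h' (s * x' + c * y) \<partial>\<nu>\<bar> \<le> (s * \<bar>x - x'\<bar>) * sqrt (2 / pi) + 0"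
        proof (rule std_normal_expectation_abs_le)
          fix y :: real
          have "\<bar>y\<bar> * \<bar>h' (s * x + c * y) - h' (s * x' + c * y)\<bar> \<le> \<bar>y\<bar> * \<bar>(s * x + c * y) - (s * x' + c * y)\<bar>"
            by (intro mult_left_mono l') simp
          also have "\<dots> = (s * \<bar>x - x'\<bar>) * \<bar>y\<bar> + 0"
            using s by (simp add: abs_mult right_diff_distrib[symmetric])
          finally show "\<bar>y * h' (s * x + c * y) - y * h' (s * x' + c * y)\<bar> \<le> (s * \<bar>x - x'\<bar>) * \<bar>y\<bar> + 0"
            by (simp add: abs_mult[symmetric] right_diff_distrib)
        qed measurable
        then have "\<bar>c * K x - c * K x'\<bar> \<le> s * \<bar>x - x'\<bar> * sqrt (2 / pi)"
          using iyh c by (simp add: K)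
        then have "c * \<bar>K x - K x'\<bar> \<le> s * \<bar>x - x'\<bar> * sqrt (2 / pi)"
          using c by (simp add: right_diff_distrib[symmetric] abs_mult)
        then show ?thesis using c by (simp add: field_simps)
      qed
    qed
    then show "\<bar>(\<integral>x. (\<integral>y. h'' (sin \<theta> * x + cos \<theta> * y) \<partial>\<nu>) \<partial>\<mu>) - (\<integral>x. (\<integral>y. h'' (sin \<theta> * x + cos \<theta> * y) \<partial>\<nu>) \<partial>\<kappa>)\<bar> \<le> \<Lambda> \<theta>"
      unfolding \<Lambda>_def K_def s_def c_def .
  qed
  also have "\<Gamma> (pi / 2) - \<Gamma> 0 = sqrt (2 * pi) / 4 * z"
  proof -
    have "sqrt (2 / pi) * pi = sqrt (2 * pi)"
    proof -
      have "sqrt (2 / pi) * pi = sqrt 2 * (pi / sqrt pi)" by (simp add: real_sqrt_divide)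
      also have "\<dots> = sqrt 2 * sqrt pi" by (simp only: real_div_sqrt pi_ge_zero)
      also have "\<dots> = sqrt (2 * pi)" by (simp add: real_sqrt_mult)
      finally show ?thesis .
    qed
    then show ?thesis unfolding \<Gamma>_def by (simp add: field_simps)
  qed
  finally show ?thesis .
qed

text \<open>Replacing \<open>h\<close> by its average over \<open>[x, x + \<epsilon>]\<close> gains one derivative without
  increasing any Lipschitz constant.\<close>

lemma second_order_test_le:
  assumes h: "\<And>x. (h has_real_derivative h' x) (at x)"
    and bd: "\<And>x. \<bar>h x\<bar> \<le> C" "\<And>x. \<bar>h' x\<bar> \<le> C" and lip: "\<And>x y. \<bar>h' x - h' y\<bar> \<le> \<bar>x - y\<bar>"
  shows "\<bar>(\<integral>x. h x \<partial>\<mu>) - (\<integral>x. h x \<partial>\<nu>)\<bar> \<le> sqrt (2 * pi) / 4 * z"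
proof (rule field_le_epsilon)
  fix e :: real assume "0 < e"
  interpret \<mu>: prob_space \<mu> by (rule prob_\<mu>)
  interpret \<nu>: prob_space \<nu> by (rule prob_space_std_normal)
  have C0: "0 \<le> C" using bd(1)[of 0] by linarith
  \<comment> \<open>Smoothing costs at most \<open>C * \<epsilon>\<close> under each of \<mu> and
    \<nu>; the summand 1 keeps the denominator positive when \<open>C\<close> is 0.\<close>
  define \<epsilon> where "\<epsilon> = e / (2 * C + 1)"
  have \<epsilon>: "0 < \<epsilon>" "2 * (C * \<epsilon>) \<le> e"
    using \<open>0 < e\<close> C0 unfolding \<epsilon>_def by (auto simp: field_simps)
  have ch: "continuous_on UNIV h" using h by (auto intro: DERIV_isCont continuous_at_imp_continuous_on)
  have ch': "continuous_on UNIV h'" using continuous_on_lipschitz[of h' 1] lip by simp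
  have ic: "isCont h y" for y using ch by (simp add: continuous_on_eq_continuous_at)
  have "\<exists>H. \<forall>x. - \<infinity> < ereal x \<longrightarrow> ereal x < \<infinity> \<longrightarrow> (H has_vector_derivative h x) (at x)"
    by (rule einterval_antiderivative) (simp_all add: ic)
  then obtain H where H: "(H has_real_derivative h x) (at x)" for x
    by (auto simp: has_real_derivative_iff_has_vector_derivative)
  have shift: "((\<lambda>x. (f (x + \<epsilon>) - f x) / \<epsilon>) has_real_derivative (f' (x + \<epsilon>) - f' x) / \<epsilon>) (at x)"
    if "\<And>x. (f has_real_derivative f' x) (at x)" for f f' :: "real \<Rightarrow> real" and x
    by (intro DERIV_cdivide DERIV_diff that) (use that[of "x + \<epsilon>"] in \<open>simp add: DERIV_shift\<close>)
  \<comment> \<open>By the mean value theorem \<open>k x\<close> is a value of \<open>h\<close> on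
    the averaging window, so \<open>k\<close> inherits the bound \<open>C\<close> and stays within
    \<open>C * \<epsilon>\<close> of \<open>h\<close>.\<close>
  define k where "k = (\<lambda>x. (H (x + \<epsilon>) - H x) / \<epsilon>)"
  have mvt: "\<exists>\<xi>. x < \<xi> \<and> \<xi> < x + \<epsilon> \<and> k x = h \<xi>" for x
  proof -
    obtain \<xi> where "x < \<xi>" "\<xi> < x + \<epsilon>" "H (x + \<epsilon>) - H x = (x + \<epsilon> - x) * h \<xi>"
      using MVT2[of x "x + \<epsilon>" H h] \<epsilon> H by auto
    then show ?thesis using \<epsilon> unfolding k_def by auto
  qed
  have lh: "\<bar>h x - h y\<bar> \<le> C * \<bar>x - y\<bar>" for x y
    using field_differentiable_bound[of UNIV h h' C x y] h bd by simp
  have kb: "\<bar>k x\<bar> \<le> C" for x using mvt[of x] bd(1) by auto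
  have kd: "\<bar>k x - h x\<bar> \<le> C * \<epsilon>" for x
  proof -
    obtain \<xi> where \<xi>: "x < \<xi>" "\<xi> < x + \<epsilon>" "k x = h \<xi>" using mvt[of x] by auto
    have "\<bar>h \<xi> - h x\<bar> \<le> C * \<bar>\<xi> - x\<bar>" by (rule lh)
    also have "\<dots> \<le> C * \<epsilon>" using \<xi> C0 by (intro mult_left_mono) auto
    finally show ?thesis using \<xi> by simp
  qed
  have Dk: "(k has_real_derivative (h (x + \<epsilon>) - h x) / \<epsilon>) (at x)" for x
    unfolding k_def by (rule shift[OF H])
  have main: "\<bar>(\<integral>x. k x \<partial>\<mu>) - (\<integral>x. k x \<partial>\<nu>)\<bar> \<le> sqrt (2 * pi) / 4 * z"
  \<comment> \<open>The derivatives of \<open>k\<close> are difference quotients of \<open>h\<close>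
    and \<open>h'\<close>, so the Lipschitz constants of these become sup bounds, and the second
    derivative is continuous.\<close>
  proof (rule second_order_smooth_test_le[OF Dk shift[OF h] _ kb])
    show "continuous_on UNIV (\<lambda>x. (h' (x + \<epsilon>) - h' x) / \<epsilon>)"
      using \<epsilon> by (intro continuous_intros continuous_on_compose2[OF ch']) auto
    show "\<bar>(h (x + \<epsilon>) - h x) / \<epsilon>\<bar> \<le> C" for x
      using lh[of "x + \<epsilon>" x] \<epsilon> by (simp add: abs_divide divide_le_eq)
    show "\<bar>(h' (x + \<epsilon>) - h' x) / \<epsilon>\<bar> \<le> 1" for x
      using lip[of "x + \<epsilon>" x] \<epsilon> by (simp add: abs_divide divide_le_eq)
  qed
  have near: "\<bar>(\<integral>x. k x \<partial>M) - (\<integral>x. h x \<partial>M)\<bar> \<le> C * \<epsilon>" if "prob_space M" "sets M = sets borel" for M :: "real measure"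
  proof -
    interpret M: prob_space M by fact
    note [measurable_cong] = \<open>sets M = sets borel\<close>
    have [measurable]: "h \<in> borel_measurable borel" "k \<in> borel_measurable borel"
      using ch Dk by (auto intro!: borel_measurable_continuous_onI intro: DERIV_isCont continuous_at_imp_continuous_on)
    have i: "integrable M h" "integrable M k"
      by (rule M.integrable_const_bound[of _ C], use bd kb in auto)+
    have "\<bar>\<integral>x. k x - h x \<partial>M\<bar> \<le> (\<integral>x. \<bar>k x - h x\<bar> \<partial>M)" by (rule integral_abs_bound)
    also have "\<dots> \<le> (\<integral>x. C * \<epsilon> \<partial>M)" by (rule integral_mono) (use i kd in auto)
    finally show ?thesis using i M.prob_space by simp
  qed
  have "\<bar>(\<integral>x. k x \<partial>\<nu>) - (\<integral>x. h x \<partial>\<nu>)\<bar> \<le> C * \<epsilon>"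
    by (rule near[OF prob_space_std_normal]) simp
  with main near[OF prob_\<mu> sets_\<mu>] show "\<bar>(\<integral>x. h x \<partial>\<mu>) - (\<integral>x. h x \<partial>\<nu>)\<bar> \<le> sqrt (2 * pi) / 4 * z + e"
    using \<epsilon>(2) by linarith
qed

text \<open>Here \<open>h''\<close> is itself 1-Lipschitz, so its Gaussian average has Lipschitz
  constant \<open>s\<close>. Weighted by \<open>s * c\<close> this is the derivative of a third of
  the cubed sine, whence 1/3.\<close>

lemma third_order_test_le:
  assumes h: "\<And>x. (h has_real_derivative h' x) (at x)" and h': "\<And>x. (h' has_real_derivative h'' x) (at x)"
    and bd: "\<And>x. \<bar>h x\<bar> \<le> C" "\<And>x. \<bar>h' x\<bar> \<le> C" "\<And>x. \<bar>h'' x\<bar> \<le> C"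
    and lip: "\<And>x y. \<bar>h'' x - h'' y\<bar> \<le> \<bar>x - y\<bar>"
  shows "\<bar>(\<integral>x. h x \<partial>\<mu>) - (\<integral>x. h x \<partial>\<nu>)\<bar> \<le> 1 / 3 * z"
proof -
  define \<Gamma> where "\<Gamma> = (\<lambda>\<theta>. z * (sin \<theta> ^ 3 / 3))"
  have c'': "continuous_on UNIV h''" using continuous_on_lipschitz[of h'' 1] lip by simp
  then have [measurable]: "h'' \<in> borel_measurable borel"
    by (rule borel_measurable_continuous_onI)
  have "\<bar>(\<integral>x. h x \<partial>\<mu>) - (\<integral>x. h x \<partial>\<nu>)\<bar> \<le> \<Gamma> (pi / 2) - \<Gamma> 0"
  proof (rule gaussian_interpolation_le[OF prob_\<mu> sets_\<mu> int_id prob_\<kappa> sets_\<kappa> bias h h' c'' bd])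
    show "(\<Gamma> has_real_derivative sin \<theta> * cos \<theta> * (sin \<theta> * z)) (at \<theta>)" for \<theta>
      unfolding \<Gamma>_def by (auto intro!: derivative_eq_intros simp: power2_eq_square)
    show "continuous_on {0..pi / 2} \<Gamma>" unfolding \<Gamma>_def by (auto intro!: continuous_intros)
    fix \<theta> :: real assume \<theta>: "0 < \<theta>" "\<theta> < pi / 2"
    define s c where "s = sin \<theta>" and "c = cos \<theta>"
    have s: "0 < s" using \<theta> by (auto simp: s_def intro: sin_gt_zero)
    define K where "K = (\<lambda>x. \<integral>y. h'' (s * x + c * y) \<partial>\<nu>)"
    have ih: "integrable \<nu> (\<lambda>y. h'' (s * x + c * y))" for x
      by (rule std_normal_expectation_abs_le[of _ 0 C]) (auto simp: bd)
    have "\<bar>(\<integral>x. K x \<partial>\<mu>) - (\<integral>x. K x \<partial>\<kappa>)\<bar> \<le> s * z"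
    proof (rule lipschitz_le)
      show "0 < s" by (rule s)
      show "\<bar>K x\<bar> \<le> 0 * sqrt (2 / pi) + C" for x
        unfolding K_def by (rule std_normal_expectation_abs_le) (auto simp: bd)
      show "\<bar>K x - K x'\<bar> \<le> s * \<bar>x - x'\<bar>" for x x'
      proof -
        have "\<bar>\<integral>y. h'' (s * x + c * y) - h'' (s * x' + c * y) \<partial>\<nu>\<bar> \<le> 0 * sqrt (2 / pi) + s * \<bar>x - x'\<bar>"
        proof (rule std_normal_expectation_abs_le)
          fix y :: real
          have "\<bar>h'' (s * x + c * y) - h'' (s * x' + c * y)\<bar> \<le> \<bar>(s * x + c * y) - (s * x' + c * y)\<bar>"
            by (rule lip)
          also have "\<dots> = 0 * \<bar>y\<bar> + s * \<bar>x - x'\<bar>"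
            using s by (simp add: abs_mult right_diff_distrib[symmetric])
          finally show "\<bar>h'' (s * x + c * y) - h'' (s * x' + c * y)\<bar> \<le> 0 * \<bar>y\<bar> + s * \<bar>x - x'\<bar>" .
        qed measurable
        then show ?thesis using ih by (simp add: K_def)
      qed
    qed
    then show "\<bar>(\<integral>x. (\<integral>y. h'' (sin \<theta> * x + cos \<theta> * y) \<partial>\<nu>) \<partial>\<mu>) - (\<integral>x. (\<integral>y. h'' (sin \<theta> * x + cos \<theta> * y) \<partial>\<nu>) \<partial>\<kappa>)\<bar> \<le> sin \<theta> * z"
      unfolding K_def s_def c_def .
  qed
  then show ?thesis unfolding \<Gamma>_def by simp
qed

end

section \<open>Bounds for the zeta metrics\<close>

text \<open>The supremum of quotients over distinct points becomes an inequality for all pairs,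
  trivial on the diagonal; the value \<infinity> outside \<open>C_diff\<close> turns into a
  membership condition.\<close>

lemma F_class_iff:
  "f \<in> F_class r \<longleftrightarrow> bounded (range f) \<and> C_diff (r - 1) f \<and>
    (\<forall>x y. \<bar>(deriv ^^ (r - 1)) f x - (deriv ^^ (r - 1)) f y\<bar> \<le> \<bar>x - y\<bar>)"
proof -
  have "ereal \<bar>(a - b) / (x - y)\<bar> \<le> 1 \<longleftrightarrow> \<bar>a - b\<bar> \<le> \<bar>x - y\<bar>" if "x \<noteq> y" for a b x y :: real
    using that by (simp add: one_ereal_def abs_divide divide_le_eq)
  then have "(SUP (x, y)\<in>{(x, y). x \<noteq> y}.
        ereal \<bar>((deriv ^^ (r - 1)) f x - (deriv ^^ (r - 1)) f y) / (x - y)\<bar>) \<le> 1 \<longleftrightarrow>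
      (\<forall>x y. x \<noteq> y \<longrightarrow> \<bar>(deriv ^^ (r - 1)) f x - (deriv ^^ (r - 1)) f y\<bar> \<le> \<bar>x - y\<bar>)"
    by (auto simp: SUP_le_iff)
  also have "\<dots> \<longleftrightarrow> (\<forall>x y. \<bar>(deriv ^^ (r - 1)) f x - (deriv ^^ (r - 1)) f y\<bar> \<le> \<bar>x - y\<bar>)"
    by (metis abs_zero diff_self order_refl)
  finally show ?thesis by (auto simp: F_class_def M_const_def)
qed

lemma bounded_range_real: "bounded (range f) \<longleftrightarrow> (\<exists>B. \<forall>x. \<bar>f x\<bar> \<le> B)" for f :: "'a \<Rightarrow> real"
  by (simp add: bounded_iff)

lemma F_class_1_iff: "f \<in> F_class 1 \<longleftrightarrow> (\<exists>B. \<forall>x. \<bar>f x\<bar> \<le> B) \<and> (\<forall>x y. \<bar>f x - f y\<bar> \<le> \<bar>x - y\<bar>)"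
  using continuous_on_lipschitz[of f 1 UNIV] by (auto simp: F_class_iff bounded_range_real C_diff_def)

text \<open>Boundedness of the derivative is not part of the class. The mean value theorem on a unit
  interval finds a point where the derivative is at most \<open>2 * B\<close>, and the Lipschitz
  condition carries this to \<open>x\<close> at a cost of 1.\<close>

lemma F_class_2E:
  assumes "f \<in> F_class 2"
  obtains f' C where "\<And>x. (f has_real_derivative f' x) (at x)" "\<And>x. \<bar>f x\<bar> \<le> C" "\<And>x. \<bar>f' x\<bar> \<le> C"
    "\<And>x y. \<bar>f' x - f' y\<bar> \<le> \<bar>x - y\<bar>"
proof -
  obtain B where B: "\<And>x. \<bar>f x\<bar> \<le> B" and d: "\<And>x. f differentiable at x"
    and lip: "\<And>x y. \<bar>deriv f x - deriv f y\<bar> \<le> \<bar>x - y\<bar>"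
    using assms by (auto simp: F_class_iff bounded_range_real C_diff_def)
  have D: "(f has_real_derivative deriv f x) (at x)" for x
    using d[of x] by (simp add: DERIV_deriv_iff_real_differentiable)
  have "\<bar>deriv f x\<bar> \<le> 2 * B + 1" for x
  proof -
    obtain \<xi> where \<xi>: "x < \<xi>" "\<xi> < x + 1" "f (x + 1) - f x = (x + 1 - x) * deriv f \<xi>"
      using MVT2[of x "x + 1" f "deriv f"] D by auto
    then have "\<bar>deriv f \<xi>\<bar> \<le> 2 * B" using B[of x] B[of "x + 1"] by simp
    then show ?thesis using lip[of x \<xi>] \<xi> by linarith
  qed
  moreover have "\<bar>f x\<bar> \<le> 2 * B + 1" for x using B[of x] by linarith
  ultimately show ?thesis using that[OF D _ _ lip] by blast
qed

text \<open>A second difference of \<open>f\<close> over three equally spaced points bounds the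
  second derivative somewhere within distance 2 of \<open>x\<close>, hence everywhere; the first
  derivative follows as in the second-order case.\<close>

lemma F_class_3E:
  assumes "f \<in> F_class 3"
  obtains f' f'' C where "\<And>x. (f has_real_derivative f' x) (at x)" "\<And>x. (f' has_real_derivative f'' x) (at x)"
    "\<And>x. \<bar>f x\<bar> \<le> C" "\<And>x. \<bar>f' x\<bar> \<le> C" "\<And>x. \<bar>f'' x\<bar> \<le> C" "\<And>x y. \<bar>f'' x - f'' y\<bar> \<le> \<bar>x - y\<bar>"
proof -
  obtain B where B: "\<And>x. \<bar>f x\<bar> \<le> B" and d: "\<And>j x. j < 2 \<Longrightarrow> (deriv ^^ j) f differentiable at x"
    and lip: "\<And>x y. \<bar>deriv (deriv f) x - deriv (deriv f) y\<bar> \<le> \<bar>x - y\<bar>"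
    using assms by (auto simp: F_class_iff bounded_range_real C_diff_def numeral_2_eq_2)
  have D: "(f has_real_derivative deriv f x) (at x)" for x
    using d[of 0 x] by (simp add: DERIV_deriv_iff_real_differentiable)
  have D': "(deriv f has_real_derivative deriv (deriv f) x) (at x)" for x
    using d[of 1 x] by (simp add: DERIV_deriv_iff_real_differentiable)
  have b'': "\<bar>deriv (deriv f) x\<bar> \<le> 4 * B + 2" for x
  proof -
    \<comment> \<open>The mean value theorem for the first difference \<open>g\<close>, then for
      \<open>deriv f\<close>, expresses the second difference as a value of the second derivative;
      four values of \<open>f\<close> give \<open>4 * B\<close>.\<close>
    define g where "g = (\<lambda>t. f (t + 1) - f t)"
    have Dg: "(g has_real_derivative deriv f (t + 1) - deriv f t) (at t)" for t
      unfolding g_def by (intro DERIV_diff D) (use D[of "t + 1"] in \<open>simp add: DERIV_shift\<close>)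
    obtain \<eta> where \<eta>: "x < \<eta>" "\<eta> < x + 1" "g (x + 1) - g x = (x + 1 - x) * (deriv f (\<eta> + 1) - deriv f \<eta>)"
      using MVT2[of x "x + 1" g "\<lambda>t. deriv f (t + 1) - deriv f t"] Dg by auto
    obtain \<xi> where \<xi>: "\<eta> < \<xi>" "\<xi> < \<eta> + 1" "deriv f (\<eta> + 1) - deriv f \<eta> = (\<eta> + 1 - \<eta>) * deriv (deriv f) \<xi>"
      using MVT2[of \<eta> "\<eta> + 1" "deriv f" "deriv (deriv f)"] D' by auto
    have "deriv (deriv f) \<xi> = f (x + 1 + 1) - f (x + 1) - (f (x + 1) - f x)"
      using \<eta>(3) \<xi>(3) by (simp add: g_def)
    then have "\<bar>deriv (deriv f) \<xi>\<bar> \<le> 4 * B" using B[of x] B[of "x + 1"] B[of "x + 1 + 1"] by linarith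
    then show ?thesis using lip[of x \<xi>] \<xi> \<eta> by linarith
  qed
  have b': "\<bar>deriv f x\<bar> \<le> 6 * B + 2" for x
  proof -
    obtain \<xi> where \<xi>: "x < \<xi>" "\<xi> < x + 1" "f (x + 1) - f x = (x + 1 - x) * deriv f \<xi>"
      using MVT2[of x "x + 1" f "deriv f"] D by auto
    then have "\<bar>deriv f \<xi>\<bar> \<le> 2 * B" using B[of x] B[of "x + 1"] by simp
    have "\<bar>deriv f x - deriv f \<xi>\<bar> \<le> (4 * B + 2) * \<bar>x - \<xi>\<bar>"
      using field_differentiable_bound[of UNIV "deriv f" "deriv (deriv f)" "4 * B + 2" x \<xi>] D' b'' by simp
    also have "\<dots> \<le> (4 * B + 2) * 1"
      using \<xi> B[of x] by (intro mult_left_mono) auto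
    finally have "\<bar>deriv f x - deriv f \<xi>\<bar> \<le> 4 * B + 2" by simp
    with \<open>\<bar>deriv f \<xi>\<bar> \<le> 2 * B\<close> show ?thesis by linarith
  qed
  have B0: "0 \<le> B" using B[of 0] by linarith
  show ?thesis
  proof (rule that[OF D D' _ _ _ lip])
    show "\<bar>f x\<bar> \<le> 6 * B + 2" "\<bar>deriv f x\<bar> \<le> 6 * B + 2" "\<bar>deriv (deriv f) x\<bar> \<le> 6 * B + 2" for x
      using B[of x] b'[of x] b''[of x] B0 by auto
  qed
qed

lemma F_class_3I:
  assumes D: "\<And>x. (f has_real_derivative f' x) (at x)" and D': "\<And>x. (f' has_real_derivative f'' x) (at x)"
    and b: "\<And>x. \<bar>f x\<bar> \<le> C" and lip: "\<And>x y. \<bar>f'' x - f'' y\<bar> \<le> \<bar>x - y\<bar>"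
  shows "f \<in> F_class 3"
proof -
  have 1: "deriv f = f'" using D by (auto intro: DERIV_imp_deriv)
  have 2: "deriv f' = f''" using D' by (auto intro: DERIV_imp_deriv)
  have "f differentiable at x" "f' differentiable at x" for x
    using D D' by (auto simp: real_differentiable_def)
  moreover have "continuous_on UNIV f''" using continuous_on_lipschitz[of f'' 1] lip by simp
  ultimately have "C_diff 2 f" by (auto simp: C_diff_def numeral_2_eq_2 less_Suc_eq 1 2)
  moreover have "(deriv ^^ 2) f = f''" by (simp add: numeral_2_eq_2 1 2)
  ultimately show ?thesis using b lip by (auto simp: F_class_iff bounded_range_real)
qed

section \<open>From test functions to the distances\<close>

lemma zeta_leI:
  assumes "\<And>f. f \<in> F_class r \<Longrightarrow>
    \<bar>prob_space.expectation P (\<lambda>\<omega>. f (X \<omega>)) - prob_space.expectation Q (\<lambda>\<omega>. f (Y \<omega>))\<bar> \<le> c"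
  shows "zeta r P X Q Y \<le> ereal c"
  unfolding zeta_def by (rule SUP_least) (simp add: assms)

lemma zeta_geI:
  assumes "f \<in> F_class r"
  shows "ereal \<bar>prob_space.expectation P (\<lambda>\<omega>. f (X \<omega>)) - prob_space.expectation Q (\<lambda>\<omega>. f (Y \<omega>))\<bar> \<le> zeta r P X Q Y"
  unfolding zeta_def by (rule SUP_upper[OF assms])

lemma zeta_1_lipschitz_le:
  assumes z: "zeta 1 P X Q Y = ereal z" and L: "0 < L"
    and lip: "\<And>x y. \<bar>g x - g y\<bar> \<le> L * \<bar>x - y\<bar>" and b: "\<And>x. \<bar>g x\<bar> \<le> C"
  shows "\<bar>prob_space.expectation P (\<lambda>\<omega>. g (X \<omega>)) - prob_space.expectation Q (\<lambda>\<omega>. g (Y \<omega>))\<bar> \<le> L * z"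
proof -
  have "(\<lambda>x. g x / L) \<in> F_class 1"
    unfolding F_class_1_iff
  proof (intro conjI exI allI)
    show "\<bar>g x / L\<bar> \<le> C / L" for x using b L by (simp add: abs_divide divide_right_mono)
    show "\<bar>g x / L - g y / L\<bar> \<le> \<bar>x - y\<bar>" for x y
      using lip[of x y] L by (simp add: diff_divide_distrib[symmetric] abs_divide divide_le_eq mult.commute)
  qed
  from zeta_geI[OF this, of P X Q Y] have
    "\<bar>(\<integral>\<omega>. g (X \<omega>) \<partial>P) / L - (\<integral>\<omega>. g (Y \<omega>) \<partial>Q) / L\<bar> \<le> z"
    unfolding z by simp
  then show ?thesis using L by (simp add: diff_divide_distrib[symmetric] abs_divide divide_le_eq mult.commute)
qed

text \<open>For bounded test functions with bounded measurable derivative, both integrability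
  conditions in \<open>zero_biased\<close> hold, and unit variance removes the factor.\<close>

lemma zero_biased_laws:
  assumes P: "prob_space P" and S: "S \<in> borel_measurable P" "integrable P S"
    and var: "prob_space.variance P S = 1"
    and zb: "zero_biased P S Q V" and z: "zeta 1 P S Q V = ereal z"
  shows "zero_bias_laws (distr P borel S) (distr Q borel V) z"
proof -
  interpret P: prob_space P by fact
  have Q: "prob_space Q" and V [measurable]: "V \<in> borel_measurable Q" using zb by (auto simp: zero_biased_def)
  interpret Q: prob_space Q by fact
  note [measurable] = S(1)
  show ?thesis
  proof (rule zero_bias_laws.intro)
    show "prob_space (distr P borel S)" "prob_space (distr Q borel V)"
      by (auto intro: P.prob_space_distr Q.prob_space_distr)
    show "integrable (distr P borel S) (\<lambda>x. x)" using S by (simp add: integrable_distr_eq)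
  next
    fix K K' :: "real \<Rightarrow> real" and C
    assume K: "\<And>x. (K has_real_derivative K' x) (at x)" and b: "\<And>x. \<bar>K x\<bar> \<le> C" "\<And>x. \<bar>K' x\<bar> \<le> C"
      and [measurable]: "K' \<in> borel_measurable borel"
    have "continuous_on UNIV K" using K by (meson DERIV_isCont continuous_at_imp_continuous_on)
    then have [measurable]: "K \<in> borel_measurable borel" by (rule borel_measurable_continuous_onI)
    have dK: "deriv K = K'" using K by (auto intro: DERIV_imp_deriv)
    have "integrable P (\<lambda>\<omega>. S \<omega> * K (S \<omega>))"
    proof (rule integrable_real_dominated)
      show "integrable P (\<lambda>\<omega>. \<bar>S \<omega>\<bar> * C)" using S by simp
      show "\<bar>S \<omega> * K (S \<omega>)\<bar> \<le> \<bar>S \<omega>\<bar> * C" for \<omega> unfolding abs_mult by (intro mult_left_mono b) simp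
    qed measurable
    moreover have "integrable Q (\<lambda>\<omega>. K' (V \<omega>))"
      by (rule Q.integrable_const_bound[of _ C]) (auto simp: b)
    moreover have "\<forall>x. K differentiable at x" using K by (auto simp: real_differentiable_def)
    ultimately have "P.expectation (\<lambda>\<omega>. S \<omega> * K (S \<omega>)) = Q.expectation (\<lambda>\<omega>. K' (V \<omega>))"
      using zb var unfolding zero_biased_def dK[symmetric] by auto
    then show "(\<integral>x. x * K x \<partial>distr P borel S) = (\<integral>x. K' x \<partial>distr Q borel V)"
      by (simp add: integral_distr)
  next
    fix g :: "real \<Rightarrow> real" and L C :: real
    assume L: "0 < L" "\<And>x y. \<bar>g x - g y\<bar> \<le> L * \<bar>x - y\<bar>" "\<And>x. \<bar>g x\<bar> \<le> C"
    then have [measurable]: "g \<in> borel_measurable borel"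
      by (intro borel_measurable_continuous_onI continuous_on_lipschitz)
    show "\<bar>(\<integral>x. g x \<partial>distr P borel S) - (\<integral>x. g x \<partial>distr Q borel V)\<bar> \<le> L * z"
      using zeta_1_lipschitz_le[OF z L] by (simp add: integral_distr)
  qed simp_all
qed

lemma distributed_std_normal_expectation:
  fixes f :: "real \<Rightarrow> real"
  assumes "distributed R lborel N (\<lambda>x. ennreal (std_normal_density x))" "f \<in> borel_measurable borel"
  shows "(\<integral>\<omega>. f (N \<omega>) \<partial>R) = (\<integral>x. f x \<partial>\<nu>)"
  using distributed_integral[OF assms(1), of f] assms(2) by (simp add: integral_std_normal mult.commute)

lemma zeta_normal_le:
  assumes P: "prob_space P" and S: "S \<in> borel_measurable P" "integrable P S"
    and var: "prob_space.variance P S = 1"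
    and zb: "zero_biased P S Q V" and z: "zeta 1 P S Q V = ereal z"
    and N: "prob_space R" "distributed R lborel N (\<lambda>x. ennreal (std_normal_density x))"
  shows "zeta 1 P S R N \<le> ereal (2 * z)"
    and "zeta 2 P S R N \<le> ereal (sqrt (2 * pi) / 4 * z)"
    and "zeta 3 P S R N \<le> ereal (1 / 3 * z)"
proof -
  interpret Z: zero_bias_laws "distr P borel S" "distr Q borel V" z
    by (rule zero_biased_laws[OF P S var zb z])
  interpret R: prob_space R by (rule N)
  note [measurable] = S(1)
  have EN: "R.expectation (\<lambda>\<omega>. f (N \<omega>)) = (\<integral>x. f x \<partial>\<nu>)" and ES: "(\<integral>\<omega>. f (S \<omega>) \<partial>P) = (\<integral>x. f x \<partial>distr P borel S)"
    if "continuous_on UNIV f" for f :: "real \<Rightarrow> real"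
  proof -
    have [measurable]: "f \<in> borel_measurable borel" by (rule borel_measurable_continuous_onI[OF that])
    show "R.expectation (\<lambda>\<omega>. f (N \<omega>)) = (\<integral>x. f x \<partial>\<nu>)"
      by (rule distributed_std_normal_expectation[OF N(2)]) measurable
    show "(\<integral>\<omega>. f (S \<omega>) \<partial>P) = (\<integral>x. f x \<partial>distr P borel S)" by (simp add: integral_distr)
  qed
  have cont: "continuous_on UNIV f" if "\<And>x. (f has_real_derivative f' x) (at x)" for f f' :: "real \<Rightarrow> real"
    using that by (meson DERIV_isCont continuous_at_imp_continuous_on)
  show "zeta 1 P S R N \<le> ereal (2 * z)"
  proof (rule zeta_leI)
    fix f assume "f \<in> F_class 1"
    then obtain B where B: "\<And>x. \<bar>f x\<bar> \<le> B" and lip: "\<And>x y. \<bar>f x - f y\<bar> \<le> \<bar>x - y\<bar>"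
      unfolding F_class_1_iff by auto
    have "continuous_on UNIV f" using continuous_on_lipschitz[of f 1] lip by simp
    then show "\<bar>(\<integral>\<omega>. f (S \<omega>) \<partial>P) - (\<integral>\<omega>. f (N \<omega>) \<partial>R)\<bar> \<le> 2 * z"
      using Z.lipschitz_test_le[OF B lip] by (simp add: EN ES)
  qed
  show "zeta 2 P S R N \<le> ereal (sqrt (2 * pi) / 4 * z)"
  proof (rule zeta_leI)
    fix f assume "f \<in> F_class 2"
    then obtain f' C where f: "\<And>x. (f has_real_derivative f' x) (at x)" "\<And>x. \<bar>f x\<bar> \<le> C" "\<And>x. \<bar>f' x\<bar> \<le> C"
      "\<And>x y. \<bar>f' x - f' y\<bar> \<le> \<bar>x - y\<bar>" by (rule F_class_2E) (rule that)
    show "\<bar>(\<integral>\<omega>. f (S \<omega>) \<partial>P) - (\<integral>\<omega>. f (N \<omega>) \<partial>R)\<bar> \<le> sqrt (2 * pi) / 4 * z"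
      unfolding EN[OF cont[OF f(1)]] ES[OF cont[OF f(1)]] by (rule Z.second_order_test_le[OF f])
  qed
  show "zeta 3 P S R N \<le> ereal (1 / 3 * z)"
  proof (rule zeta_leI)
    fix f assume "f \<in> F_class 3"
    then obtain f' f'' C where f: "\<And>x. (f has_real_derivative f' x) (at x)" "\<And>x. (f' has_real_derivative f'' x) (at x)"
      "\<And>x. \<bar>f x\<bar> \<le> C" "\<And>x. \<bar>f' x\<bar> \<le> C" "\<And>x. \<bar>f'' x\<bar> \<le> C" "\<And>x y. \<bar>f'' x - f'' y\<bar> \<le> \<bar>x - y\<bar>"
      by (rule F_class_3E) (rule that)
    show "\<bar>(\<integral>\<omega>. f (S \<omega>) \<partial>P) - (\<integral>\<omega>. f (N \<omega>) \<partial>R)\<bar> \<le> 1 / 3 * z"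
      unfolding EN[OF cont[OF f(1)]] ES[OF cont[OF f(1)]] by (rule Z.third_order_test_le[OF f])
  qed
qed

lemma (in prob_space) norm_sum_moments:
  assumes indep: "indep_vars (\<lambda>_. borel) X {1..n}" and X: "\<And>j. j \<in> {1..n} \<Longrightarrow> centered_L3 M (X j)"
    and pos: "0 < (\<Sum>j=1..n. variance (X j))"
  shows "norm_sum M X n \<in> borel_measurable M" "integrable M (norm_sum M X n)" "variance (norm_sum M X n) = 1"
    and "0 < sigma_sum M X n" "(sigma_sum M X n)\<^sup>2 = (\<Sum>j=1..n. expectation (\<lambda>\<omega>. (X j \<omega>)\<^sup>2))"
proof -
  have var: "variance (X j) = expectation (\<lambda>\<omega>. (X j \<omega>)\<^sup>2)" if "j \<in> {1..n}" for j
    using X[OF that] by (simp add: centered_L3_def)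
  define \<sigma> where "\<sigma> = sigma_sum M X n"
  show \<sigma>: "0 < sigma_sum M X n" unfolding sigma_sum_def using pos by simp
  have "\<sigma>\<^sup>2 = (\<Sum>j=1..n. variance (X j))" unfolding sigma_sum_def \<sigma>_def using pos by simp
  also have "\<dots> = (\<Sum>j=1..n. expectation (\<lambda>\<omega>. (X j \<omega>)\<^sup>2))" by (rule sum.cong) (simp_all add: var)
  finally show \<sigma>2: "(sigma_sum M X n)\<^sup>2 = (\<Sum>j=1..n. expectation (\<lambda>\<omega>. (X j \<omega>)\<^sup>2))" unfolding \<sigma>_def .
  have ns: "norm_sum M X n = (\<lambda>\<omega>. (\<Sum>j=1..n. X j \<omega>) / \<sigma>)"
    by (rule ext) (simp add: norm_sum_def \<sigma>_def)
  have iX: "integrable M (X j)" and eX: "expectation (X j) = 0" if "j \<in> {1..n}" for j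
    using X[OF that] by (auto simp: centered_L3_def)
  have iS: "integrable M (\<lambda>\<omega>. \<Sum>j=1..n. X j \<omega>)" by (intro Bochner_Integration.integrable_sum iX)
  then show "integrable M (norm_sum M X n)" unfolding ns by simp
  then show "norm_sum M X n \<in> borel_measurable M" by simp
  have mean: "expectation (norm_sum M X n) = 0" 
  proof -
    have "expectation (\<lambda>\<omega>. \<Sum>j=1..n. X j \<omega>) = (\<Sum>j=1..n. expectation (X j))"
      by (intro Bochner_Integration.integral_sum iX)
    also have "\<dots> = 0" by (intro sum.neutral ballI eX)
    finally show ?thesis unfolding ns by simp
  qed
  have "expectation (\<lambda>\<omega>. (\<Sum>j=1..n. X j \<omega>)\<^sup>2) = \<sigma>\<^sup>2"
    unfolding \<sigma>_def \<sigma>2 by (rule expectation_square_sum[OF _ indep X]) auto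
  moreover have "variance (norm_sum M X n) = expectation (\<lambda>\<omega>. (\<Sum>j=1..n. X j \<omega>)\<^sup>2 / \<sigma>\<^sup>2)"
    unfolding mean by (simp add: ns power_divide)
  ultimately show "variance (norm_sum M X n) = 1"
    using \<sigma> by (simp add: \<sigma>_def)
qed

text \<open>The antiderivative of a test function is inserted into the zero bias identity, and the
  bound for sums is applied after undoing the normalization. Only one direction has to be shown,
  because \<open>- f\<close> is again a test function.\<close>

lemma zeta_zero_bias_le_lyapunov:
  assumes P: "prob_space P" and indep: "prob_space.indep_vars P (\<lambda>_. borel) X {1..n}"
    and X: "\<And>j. j \<in> {1..n} \<Longrightarrow> centered_L3 P (X j)"
    and pos: "0 < (\<Sum>j=1..n. prob_space.variance P (X j))"
    and zb: "zero_biased P (norm_sum P X n) Q V"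
  shows "zeta 1 P (norm_sum P X n) Q V \<le> ereal (lyapunov P X n / 2)"
proof (rule zeta_leI)
  interpret P: prob_space P by fact
  have Q: "prob_space Q" and V [measurable]: "V \<in> borel_measurable Q" using zb by (auto simp: zero_biased_def)
  interpret Q: prob_space Q by fact
  note m = P.norm_sum_moments[OF indep X pos]
  define \<sigma> S where "\<sigma> = sigma_sum P X n" and "S = norm_sum P X n"
  define \<beta> where "\<beta> = (\<Sum>j=1..n. P.expectation (\<lambda>\<omega>. \<bar>X j \<omega>\<bar> ^ 3))"
  have \<sigma>: "0 < \<sigma>" and \<sigma>2: "\<sigma>\<^sup>2 = (\<Sum>j=1..n. P.expectation (\<lambda>\<omega>. (X j \<omega>)\<^sup>2))"
    using m unfolding \<sigma>_def by auto
  have S: "(\<Sum>j=1..n. X j \<omega>) = \<sigma> * S \<omega>" for \<omega>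
    using \<sigma> by (simp add: S_def norm_sum_def \<sigma>_def)
  have one: "Q.expectation (\<lambda>\<omega>. f (V \<omega>)) - P.expectation (\<lambda>\<omega>. f (S \<omega>)) \<le> lyapunov P X n / 2"
    if B: "\<And>x. \<bar>f x\<bar> \<le> B" and lip: "\<And>x y. \<bar>f x - f y\<bar> \<le> \<bar>x - y\<bar>" for f B
  proof -
    have cf: "continuous_on UNIV f" using continuous_on_lipschitz[of f 1] lip by simp
    have [measurable]: "f \<in> borel_measurable borel" by (rule borel_measurable_continuous_onI[OF cf])
    have ic: "isCont f y" for y using cf by (simp add: continuous_on_eq_continuous_at)
    have "\<exists>F. \<forall>x. - \<infinity> < ereal x \<longrightarrow> ereal x < \<infinity> \<longrightarrow> (F has_vector_derivative f x) (at x)"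
      by (rule einterval_antiderivative) (simp_all add: ic)
    then obtain F where F: "(F has_real_derivative f x) (at x)" for x
      by (auto simp: has_real_derivative_iff_has_vector_derivative)
    have dF: "deriv F = f" using F by (auto intro: DERIV_imp_deriv)
    \<comment> \<open>This scaling keeps the Lipschitz constant 1 while the argument changes by
      \<sigma>. The functional picks up \<open>\<sigma> ^ 3\<close>, the denominator of
      \<open>lyapunov\<close>.\<close>
    define f1 F1 where "f1 = (\<lambda>x. \<sigma> * f (x / \<sigma>))" and "F1 = (\<lambda>x. \<sigma>\<^sup>2 * F (x / \<sigma>))"
    have f1: "\<bar>f1 x - f1 y\<bar> \<le> \<bar>x - y\<bar>" "\<bar>f1 x\<bar> \<le> \<sigma> * B" "(F1 has_real_derivative f1 x) (at x)" for x y
    proof -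
      have "\<bar>f1 x - f1 y\<bar> = \<sigma> * \<bar>f (x / \<sigma>) - f (y / \<sigma>)\<bar>"
        unfolding f1_def right_diff_distrib[symmetric] abs_mult using \<sigma> by simp
      also have "\<dots> \<le> \<sigma> * \<bar>x / \<sigma> - y / \<sigma>\<bar>" using \<sigma> by (intro mult_left_mono lip) auto
      also have "\<dots> = \<bar>x - y\<bar>" using \<sigma> by (simp add: diff_divide_distrib[symmetric] abs_divide)
      finally show "\<bar>f1 x - f1 y\<bar> \<le> \<bar>x - y\<bar>" .
      show "\<bar>f1 x\<bar> \<le> \<sigma> * B" unfolding f1_def abs_mult using \<sigma> B by (auto intro!: mult_mono)
      show "(F1 has_real_derivative f1 x) (at x)" unfolding F1_def f1_def
        using \<sigma> by (auto intro!: derivative_eq_intros DERIV_chain2[OF F] simp: power2_eq_square)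
    qed
    note Z = P.zero_bias_functional_sum_le[OF finite_atLeastAtMost indep X f1]
    have eq: "\<sigma> * S \<omega> * F1 (\<sigma> * S \<omega>) = \<sigma> ^ 3 * (S \<omega> * F (S \<omega>))" for \<omega>
      using \<sigma> unfolding F1_def by (simp add: power2_eq_square power3_eq_cube)
    have i: "integrable P (\<lambda>\<omega>. S \<omega> * F (S \<omega>))"
      using Z(1) \<sigma> unfolding S eq by simp
    have "P.expectation (\<lambda>\<omega>. \<sigma> * S \<omega> * F1 (\<sigma> * S \<omega>)) - \<sigma>\<^sup>2 * P.expectation (\<lambda>\<omega>. f1 (\<sigma> * S \<omega>)) \<le> \<beta> / 2"
      using Z(2) unfolding S \<sigma>2 \<beta>_def by simp
    then have 1: "\<sigma> ^ 3 * (P.expectation (\<lambda>\<omega>. S \<omega> * F (S \<omega>)) - P.expectation (\<lambda>\<omega>. f (S \<omega>))) \<le> \<beta> / 2"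
      unfolding eq using \<sigma> by (simp add: f1_def power2_eq_square power3_eq_cube algebra_simps)
    have "integrable Q (\<lambda>\<omega>. f (V \<omega>))" by (rule Q.integrable_const_bound[of _ B]) (auto simp: B)
    moreover have "\<forall>x. F differentiable at x" using F by (auto simp: real_differentiable_def)
    \<comment> \<open>\<open>F\<close> may be unbounded; the left expectation exists by
      \<open>Z(1)\<close>, and the variance factor is 1.\<close>
    ultimately have "P.expectation (\<lambda>\<omega>. S \<omega> * F (S \<omega>)) = Q.expectation (\<lambda>\<omega>. f (V \<omega>))"
      using zb i m(3) unfolding zero_biased_def dF[symmetric] S_def by auto
    with 1 have "Q.expectation (\<lambda>\<omega>. f (V \<omega>)) - P.expectation (\<lambda>\<omega>. f (S \<omega>)) \<le> \<beta> / 2 / \<sigma> ^ 3"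
      using \<sigma> by (simp add: pos_le_divide_eq mult.commute)
    then show ?thesis unfolding lyapunov_def \<beta>_def \<sigma>_def by (simp add: mult.commute)
  qed
  fix f assume "f \<in> F_class 1"
  then obtain B where B: "\<And>x. \<bar>f x\<bar> \<le> B" and lip: "\<And>x y. \<bar>f x - f y\<bar> \<le> \<bar>x - y\<bar>"
    unfolding F_class_1_iff by auto
  show "\<bar>P.expectation (\<lambda>\<omega>. f (norm_sum P X n \<omega>)) - Q.expectation (\<lambda>\<omega>. f (V \<omega>))\<bar> \<le> lyapunov P X n / 2"
  proof -
    have "Q.expectation (\<lambda>\<omega>. f (V \<omega>)) - P.expectation (\<lambda>\<omega>. f (norm_sum P X n \<omega>)) \<le> lyapunov P X n / 2"
      using one[OF B lip] by (simp add: S_def)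
    moreover have "\<bar>- f x\<bar> \<le> B" "\<bar>- f x - - f y\<bar> \<le> \<bar>x - y\<bar>" for x y
      using B[of x] lip[of x y] by auto
    then have "P.expectation (\<lambda>\<omega>. f (norm_sum P X n \<omega>)) - Q.expectation (\<lambda>\<omega>. f (V \<omega>)) \<le> lyapunov P X n / 2"
      using one[of "\<lambda>x. - f x" B] by (simp add: S_def)
    ultimately show ?thesis by linarith
  qed
qed

lemma zeta_bounds:
  fixes P :: "'a measure" and X :: "nat \<Rightarrow> 'a \<Rightarrow> real" and Q :: "'b measure" and V :: "'b \<Rightarrow> real"
  assumes N: "prob_space R" "distributed R lborel N (\<lambda>x. ennreal (std_normal_density x))"
    and P: "prob_space P" and indep: "prob_space.indep_vars P (\<lambda>_. borel) X {1..n}"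
    and X: "\<forall>j\<in>{1..n}. centered_L3 P (X j)"
    and pos: "(\<Sum>j=1..n. prob_space.variance P (X j)) > 0"
    and zb: "zero_biased P (norm_sum P X n) Q V"
  shows "let S = norm_sum P X n; \<epsilon> = ereal (lyapunov P X n); z = zeta 1 P S Q V in
          zeta 1 P S R N \<le> 2 * z \<and> 2 * z \<le> \<epsilon> \<and>
          zeta 2 P S R N \<le> ereal (sqrt (2 * pi) / 4) * z \<and>
          ereal (sqrt (2 * pi) / 4) * z \<le> ereal (sqrt (2 * pi) / 8) * \<epsilon> \<and>
          zeta 3 P S R N \<le> ereal (1 / 3) * z \<and>
          ereal (1 / 3) * z \<le> ereal (1 / 6) * \<epsilon>"
proof -
  define S where "S = norm_sum P X n"
  have X': "\<And>j. j \<in> {1..n} \<Longrightarrow> centered_L3 P (X j)" using X by blast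
  note m = prob_space.norm_sum_moments[OF P indep X' pos, folded S_def]
  have le: "zeta 1 P S Q V \<le> ereal (lyapunov P X n / 2)"
    unfolding S_def by (rule zeta_zero_bias_le_lyapunov[OF P indep X' pos zb])
  \<comment> \<open>The zero function makes the distance nonnegative. With the upper bound it is
    finite, so the real-valued estimates apply to it.\<close>
  have "(\<lambda>_. 0) \<in> F_class 1" unfolding F_class_1_iff by auto
  from zeta_geI[OF this, where P = P and X = S and Q = Q and Y = V] have "0 \<le> zeta 1 P S Q V" by (simp add: zero_ereal_def)
  with le obtain z where z: "zeta 1 P S Q V = ereal z"
    by (cases "zeta 1 P S Q V") auto
  have "z \<le> lyapunov P X n / 2" using le unfolding z by simp
  moreover note B = zeta_normal_le[OF P m(1-3) zb[folded S_def] z N]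
  moreover have "sqrt (2 * pi) / 4 * z \<le> sqrt (2 * pi) / 4 * (lyapunov P X n / 2)"
    using \<open>z \<le> lyapunov P X n / 2\<close> by (intro mult_left_mono) auto
  ultimately show ?thesis
    unfolding Let_def S_def[symmetric] z by (simp del: real_sqrt_mult)
qed

section \<open>Optimality\<close>

text \<open>Third moments of independent centered variables add up: in the cube of
  \<open>X i + T\<close> each mixed term contains a first power, whose mean is zero.\<close>

lemma (in prob_space) sum_moments_bounded:
  fixes X :: "'i \<Rightarrow> 'a \<Rightarrow> real"
  assumes I: "finite I" and indep: "indep_vars (\<lambda>_. borel) X I"
    and b: "\<And>j \<omega>. j \<in> I \<Longrightarrow> \<bar>X j \<omega>\<bar> \<le> C" and mean: "\<And>j. j \<in> I \<Longrightarrow> expectation (X j) = 0"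
  shows "expectation (\<lambda>\<omega>. \<Sum>j\<in>I. X j \<omega>) = 0"
    and "expectation (\<lambda>\<omega>. (\<Sum>j\<in>I. X j \<omega>) ^ 3) = (\<Sum>j\<in>I. expectation (\<lambda>\<omega>. X j \<omega> ^ 3))"
proof -
  have int: "integrable M (\<lambda>\<omega>. Y \<omega> ^ k)"
    if [measurable]: "Y \<in> borel_measurable M" and "\<And>\<omega>. \<bar>Y \<omega>\<bar> \<le> D" for Y and D :: real and k
  proof (rule integrable_const_bound[of _ "D ^ k"])
    show "AE \<omega> in M. norm (Y \<omega> ^ k) \<le> D ^ k"
      using that(2) by (intro AE_I2) (simp add: power_abs power_mono)
  qed measurable
  have int1: "integrable M Y" if "Y \<in> borel_measurable M" "\<And>\<omega>. \<bar>Y \<omega>\<bar> \<le> D" for Y and D :: real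
    using that by (intro integrable_const_bound[of _ D]) auto
  have rv: "X j \<in> borel_measurable M" if "j \<in> I" for j using indep that by (auto simp: indep_vars_def)
  have "expectation (\<lambda>\<omega>. \<Sum>j\<in>I. X j \<omega>) = (\<Sum>j\<in>I. expectation (X j))"
    by (rule Bochner_Integration.integral_sum) (rule int1[OF rv b])
  then show "expectation (\<lambda>\<omega>. \<Sum>j\<in>I. X j \<omega>) = 0" using mean by simp
  show "expectation (\<lambda>\<omega>. (\<Sum>j\<in>I. X j \<omega>) ^ 3) = (\<Sum>j\<in>I. expectation (\<lambda>\<omega>. X j \<omega> ^ 3))"
    using I indep b mean
  proof (induction I rule: finite_induct)
    case empty
    then show ?case by simp
  next
    case (insert i I)
    define T where "T = (\<lambda>\<omega>. \<Sum>j\<in>I. X j \<omega>)"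
    have indI: "indep_vars (\<lambda>_. borel) X I" by (rule indep_vars_subset[OF insert.prems(1)]) auto
    have Xi [measurable]: "X j \<in> borel_measurable M" if "j \<in> insert i I" for j
      using insert.prems(1) that by (auto simp: indep_vars_def)
    have T [measurable]: "T \<in> borel_measurable M" unfolding T_def using Xi by simp
    have bi: "\<bar>X i \<omega>\<bar> \<le> C" for \<omega> using insert.prems(2) by simp
    have bT: "\<bar>T \<omega>\<bar> \<le> (\<Sum>j\<in>I. C)" for \<omega>
      unfolding T_def by (rule order_trans[OF sum_abs sum_mono]) (use insert.prems(2) in auto)
    have intX: "integrable M (\<lambda>\<omega>. X i \<omega> ^ k)" for k
      by (rule int[OF Xi bi]) simp
    have intT: "integrable M (\<lambda>\<omega>. T \<omega> ^ k)" for k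
      by (rule int[OF T bT])
    have "indep_var borel (X i) borel T"
      unfolding T_def by (rule indep_vars_sum[OF insert.hyps insert.prems(1)])
    then have ind: "indep_var borel (\<lambda>\<omega>. X i \<omega> ^ k) borel (\<lambda>\<omega>. T \<omega> ^ m)" for k m
      using indep_var_compose[of borel "X i" borel T "\<lambda>x. x ^ k" borel "\<lambda>x. x ^ m" borel] by (simp add: comp_def)
    have iXT: "integrable M (\<lambda>\<omega>. X i \<omega> ^ k * T \<omega> ^ m)" for k m
      by (rule indep_var_integrable[OF ind intX intT])
    have eXT: "expectation (\<lambda>\<omega>. X i \<omega> ^ k * T \<omega> ^ m) = expectation (\<lambda>\<omega>. X i \<omega> ^ k) * expectation (\<lambda>\<omega>. T \<omega> ^ m)" for k m
      by (rule indep_var_lebesgue_integral[OF ind intX intT])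
    have "expectation T = (\<Sum>j\<in>I. expectation (X j))"
      unfolding T_def by (rule Bochner_Integration.integral_sum)
        (rule int1[OF Xi insert.prems(2)], auto)
    then have eT: "expectation (\<lambda>\<omega>. T \<omega> ^ 1) = 0" using insert.prems(3) by simp
    have eX: "expectation (\<lambda>\<omega>. X i \<omega> ^ 1) = 0" using insert.prems(3) by simp
    \<comment> \<open>The exponents 1 are kept so that \<open>iXT\<close> and \<open>eXT\<close>
      match every mixed term.\<close>
    have "(\<Sum>j\<in>insert i I. X j \<omega>) ^ 3 = X i \<omega> ^ 3 + 3 * (X i \<omega> ^ 2 * T \<omega> ^ 1) + 3 * (X i \<omega> ^ 1 * T \<omega> ^ 2) + T \<omega> ^ 3" for \<omega>
      using insert.hyps by (simp add: T_def power3_eq_cube power2_eq_square algebra_simps)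
    then have "expectation (\<lambda>\<omega>. (\<Sum>j\<in>insert i I. X j \<omega>) ^ 3)
        = expectation (\<lambda>\<omega>. X i \<omega> ^ 3 + 3 * (X i \<omega> ^ 2 * T \<omega> ^ 1) + 3 * (X i \<omega> ^ 1 * T \<omega> ^ 2) + T \<omega> ^ 3)"
      by (simp only:)
    also have "\<dots> = expectation (\<lambda>\<omega>. X i \<omega> ^ 3) + 3 * expectation (\<lambda>\<omega>. X i \<omega> ^ 2 * T \<omega> ^ 1)
        + 3 * expectation (\<lambda>\<omega>. X i \<omega> ^ 1 * T \<omega> ^ 2) + expectation (\<lambda>\<omega>. T \<omega> ^ 3)"
      using iXT[of 2 1] iXT[of 1 2] intX[of 3] intT[of 3] by simp
    also have "\<dots> = expectation (\<lambda>\<omega>. X i \<omega> ^ 3) + expectation (\<lambda>\<omega>. T \<omega> ^ 3)"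
      unfolding eXT eT eX by simp
    also have "expectation (\<lambda>\<omega>. T \<omega> ^ 3) = (\<Sum>j\<in>I. expectation (\<lambda>\<omega>. X j \<omega> ^ 3))"
      unfolding T_def by (rule insert.IH[OF indI]) (use insert.prems in auto)
    finally show ?case using insert.hyps by simp
  qed
qed

lemma std_normal_integral_odd:
  fixes g :: "real \<Rightarrow> real"
  assumes "g \<in> borel_measurable borel" "\<And>x. g (- x) = - g x"
  shows "(\<integral>x. g x \<partial>\<nu>) = 0"
proof -
  have "(\<integral>x. g x * \<phi> x \<partial>lborel) = (\<integral>x. g (- x) * \<phi> (- x) \<partial>lborel)"
    using lborel_integral_real_affine[of "- 1" "\<lambda>x. g x * \<phi> x" 0] by simp
  also have "\<dots> = - (\<integral>x. g x * \<phi> x \<partial>lborel)"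
    by (simp add: assms(2) std_normal_density_def)
  finally show ?thesis using assms(1) by (simp add: integral_std_normal)
qed

lemma scaled_sin_F_class_3:
  assumes "0 < L"
  shows "(\<lambda>x. - (L ^ 3 * sin (x / L))) \<in> F_class 3"
proof (rule F_class_3I)
  show "((\<lambda>x. - (L ^ 3 * sin (x / L))) has_real_derivative - (L ^ 2 * cos (x / L))) (at x)" for x
    using assms by (auto intro!: derivative_eq_intros simp: power3_eq_cube power2_eq_square)
  show "((\<lambda>x. - (L ^ 2 * cos (x / L))) has_real_derivative L * sin (x / L)) (at x)" for x
    using assms by (auto intro!: derivative_eq_intros simp: power2_eq_square)
  have "\<bar>L ^ 3\<bar> * \<bar>sin (x / L)\<bar> \<le> \<bar>L ^ 3\<bar> * 1" for x by (intro mult_left_mono) auto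
  then show "\<bar>- (L ^ 3 * sin (x / L))\<bar> \<le> \<bar>L ^ 3\<bar>" for x by (simp add: abs_mult)
  show "\<bar>L * sin (x / L) - L * sin (y / L)\<bar> \<le> \<bar>x - y\<bar>" for x y
  proof -
    have "((\<lambda>x. L * sin (x / L)) has_real_derivative cos (x / L)) (at x)" for x
      using assms by (auto intro!: derivative_eq_intros)
    then show ?thesis
      using field_differentiable_bound[of UNIV "\<lambda>x. L * sin (x / L)" "\<lambda>x. cos (x / L)" 1 x y] by auto
  qed
qed

text \<open>The functions \<open>-L\<^sup>3 sin (x / L)\<close> have third derivative \<open>cos (x / L)\<close>; up to a linear
  term, which does not contribute, they approximate \<open>x\<^sup>3 / 6\<close> as \<open>L\<close> tends to infinity.\<close>

lemma zeta_3_ge_third_moment: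
  assumes P: "prob_space P" and S: "S \<in> borel_measurable P" and b: "\<And>\<omega>. \<bar>S \<omega>\<bar> \<le> D"
    and mean: "prob_space.expectation P S = 0"
    and N: "prob_space R" "distributed R lborel N (\<lambda>x. ennreal (std_normal_density x))"
  shows "ereal (prob_space.expectation P (\<lambda>\<omega>. S \<omega> ^ 3) / 6) \<le> zeta 3 P S R N"
proof -
  interpret P: prob_space P by fact
  interpret R: prob_space R by (rule N)
  note [measurable] = S
  define L where "L = (\<lambda>k. real (Suc k))"
  have L: "0 < L k" for k by (simp add: L_def)
  define a where "a = (\<lambda>k. P.expectation (\<lambda>\<omega>. L k ^ 3 * (S \<omega> / L k - sin (S \<omega> / L k))))"
  have intS: "integrable P S" by (rule P.integrable_const_bound[of _ D]) (use b in auto)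
  have "ereal (a k) \<le> zeta 3 P S R N" for k
  proof -
    have "R.expectation (\<lambda>\<omega>. - (L k ^ 3 * sin (N \<omega> / L k))) = (\<integral>x. - (L k ^ 3 * sin (x / L k)) \<partial>\<nu>)"
      by (rule distributed_std_normal_expectation[OF N(2)]) measurable
    also have "\<dots> = 0" by (rule std_normal_integral_odd) auto
    finally have 0: "R.expectation (\<lambda>\<omega>. - (L k ^ 3 * sin (N \<omega> / L k))) = 0" .
    have "integrable P (\<lambda>\<omega>. sin (S \<omega> / L k))" by (rule P.integrable_const_bound[of _ 1]) auto
    \<comment> \<open>The linear term added in \<open>a k\<close> has mean zero under
      \<open>P\<close>, while the normal side vanishes because the test function is odd.\<close>
    then have "a k = P.expectation (\<lambda>\<omega>. - (L k ^ 3 * sin (S \<omega> / L k)))"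
      unfolding a_def right_diff_distrib using intS mean by simp
    then have "ereal (a k) \<le> ereal \<bar>P.expectation (\<lambda>\<omega>. - (L k ^ 3 * sin (S \<omega> / L k)))
        - R.expectation (\<lambda>\<omega>. - (L k ^ 3 * sin (N \<omega> / L k)))\<bar>"
      unfolding 0 by simp
    also have "\<dots> \<le> zeta 3 P S R N" by (rule zeta_geI[OF scaled_sin_F_class_3[OF L]])
    finally show ?thesis .
  qed
  moreover have "(\<lambda>k. ereal (a k)) \<longlonglongrightarrow> ereal (P.expectation (\<lambda>\<omega>. S \<omega> ^ 3 / 6))"
  proof (intro tendsto_ereal, unfold a_def, rule integral_dominated_convergence[where w = "\<lambda>_. D ^ 3 / 6"])
    show "AE \<omega> in P. (\<lambda>k. L k ^ 3 * (S \<omega> / L k - sin (S \<omega> / L k))) \<longlonglongrightarrow> S \<omega> ^ 3 / 6"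
    proof (rule AE_I2)
      fix \<omega>
      have "(\<lambda>k. real (Suc k) ^ 3 * (x / real (Suc k) - sin (x / real (Suc k)))) \<longlonglongrightarrow> x * (x * x) / 6" for x :: real
        by real_asymp
      then show "(\<lambda>k. L k ^ 3 * (S \<omega> / L k - sin (S \<omega> / L k))) \<longlonglongrightarrow> S \<omega> ^ 3 / 6" by (simp add: L_def power3_eq_cube mult.assoc)
    qed
    show "AE \<omega> in P. norm (L k ^ 3 * (S \<omega> / L k - sin (S \<omega> / L k))) \<le> D ^ 3 / 6" for k
    proof (rule AE_I2)
      fix \<omega>
      have "\<bar>sin u - u\<bar> \<le> \<bar>u\<bar> ^ 3 / 6" for u :: real
      proof -
        \<comment> \<open>The even coefficients vanish, so the Maclaurin polynomial of order below 3
          is just \<open>u\<close>, and the remainder supplies a dominating constant independent of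
          \<open>k\<close>.\<close>
        have "{..<3::nat} = {0, 1, 2}" by auto
        then have "(\<Sum>m<3. sin_coeff m * u ^ m) = u" by (simp add: sin_coeff_def)
        moreover have "inverse (fact 3) = (1 / 6 :: real)" by (simp add: fact_numeral)
        ultimately have "\<bar>sin u - u\<bar> \<le> 1 / 6 * \<bar>u\<bar> ^ 3"
          using Maclaurin_sin_bound[of u 3] by (simp only:)
        then show ?thesis by simp
      qed
      from this[of "S \<omega> / L k"]
      have "L k ^ 3 * \<bar>S \<omega> / L k - sin (S \<omega> / L k)\<bar> \<le> L k ^ 3 * (\<bar>S \<omega> / L k\<bar> ^ 3 / 6)"
        using L[of k] by (intro mult_left_mono) (auto simp: abs_minus_commute)
      also have "\<dots> = \<bar>S \<omega>\<bar> ^ 3 / 6" using L[of k] by (simp add: power_divide abs_divide)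
      also have "\<dots> \<le> D ^ 3 / 6" using b by (intro divide_right_mono power_mono) auto
      finally show "norm (L k ^ 3 * (S \<omega> / L k - sin (S \<omega> / L k))) \<le> D ^ 3 / 6"
        using L[of k] by (simp add: abs_mult)
    qed
  qed simp_all
  ultimately have "ereal (P.expectation (\<lambda>\<omega>. S \<omega> ^ 3 / 6)) \<le> zeta 3 P S R N"
    by (intro LIMSEQ_le_const2[of "\<lambda>k. ereal (a k)"]) auto
  then show ?thesis by simp
qed

text \<open>Coordinates on an infinite product of biased coins, relabelled. The weight
  \<open>\<eta> / (1 + \<eta>)\<close> of the value 1 makes the law centered.\<close>

lemma two_point_iid_exists:
  fixes \<eta> :: real
  assumes "0 < \<eta>"
  obtains P :: "(nat \<Rightarrow> real) measure" and X :: "nat \<Rightarrow> (nat \<Rightarrow> real) \<Rightarrow> real"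
  where "prob_space P" "prob_space.indep_vars P (\<lambda>_. borel) X UNIV" "\<And>j \<omega>. X j \<omega> \<in> {1, - \<eta>}"
    and "\<And>j. distr P borel (X j) = distr P borel (X 1)"
    and "\<And>j g. g \<in> borel_measurable borel \<Longrightarrow>
      prob_space.expectation P (\<lambda>\<omega>. g (X j \<omega>)) = (\<eta> * g 1 + g (- \<eta>)) / (1 + \<eta> :: real)"
proof -
  define M :: "real measure" where "M = distr (bernoulli_pmf (\<eta> / (1 + \<eta>))) borel (\<lambda>b. if b then 1 else - 1)"
  interpret M: prob_space M
    unfolding M_def by (rule measure_pmf.prob_space_distr) simp
  have [measurable_cong]: "sets M = sets borel" by (simp add: M_def)
  define P where "P = PiM (UNIV :: nat set) (\<lambda>_. M)"
  interpret P: prob_space P unfolding P_def by (rule prob_space_PiM) (rule M.prob_space_axioms)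
  \<comment> \<open>Composing with \<open>y\<close> forces the two values at every point, not just
    almost everywhere; the pointwise bounds on the sums rely on this.\<close>
  define y where "y = (\<lambda>x :: real. if 0 < x then 1 else - \<eta>)"
  have y [measurable]: "y \<in> borel_measurable borel" unfolding y_def by measurable
  define X where "X = (\<lambda>(j :: nat) \<omega>. y (\<omega> j))"
  have comp: "(\<lambda>\<omega>. \<omega> j) \<in> measurable P M" for j unfolding P_def by measurable
  have dM: "distr P M (\<lambda>\<omega>. \<omega> j) = M" for j
    unfolding P_def by (rule distr_PiM_component) (auto intro: M.prob_space_axioms)
  have XM [measurable]: "X j \<in> borel_measurable P" for j
    unfolding X_def using measurable_compose[OF comp[of j], of y borel] by simp
  have dX: "distr P borel (X j) = distr M borel y" for j
  proof -
    have "distr M borel y = distr (distr P M (\<lambda>\<omega>. \<omega> j)) borel y" unfolding dM ..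
    also have "\<dots> = distr P borel (X j)" using comp by (subst distr_distr) (simp_all add: X_def comp_def)
    finally show ?thesis ..
  qed
  have "P.indep_vars (\<lambda>_. M) (\<lambda>j \<omega>. \<omega> j) UNIV"
  proof (subst P.indep_vars_iff_distr_eq_PiM)
    have "distr P (PiM UNIV (\<lambda>_. M)) (\<lambda>x. \<lambda>i\<in>UNIV. x i) = distr P P (\<lambda>x. x)"
      by (simp add: P_def restrict_UNIV)
    also have "\<dots> = PiM UNIV (\<lambda>i. distr P M (\<lambda>\<omega>. \<omega> i))" unfolding dM by (simp add: P_def)
    finally show "distr P (PiM UNIV (\<lambda>_. M)) (\<lambda>x. \<lambda>i\<in>UNIV. x i) = PiM UNIV (\<lambda>i. distr P M (\<lambda>\<omega>. \<omega> i))" .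
  qed (use comp in auto)
  then have ind: "P.indep_vars (\<lambda>_. borel) X UNIV"
    unfolding X_def by (rule P.indep_vars_compose2) simp
  have ex: "P.expectation (\<lambda>\<omega>. g (X j \<omega>)) = (\<eta> * g 1 + g (- \<eta>)) / (1 + \<eta>)"
    if [measurable]: "g \<in> borel_measurable borel" for j and g :: "real \<Rightarrow> real"
  proof -
    have "P.expectation (\<lambda>\<omega>. g (X j \<omega>)) = (\<integral>x. g x \<partial>distr M borel y)"
      unfolding dX[of j, symmetric] by (simp add: integral_distr)
    also have "\<dots> = (\<integral>x. g (y x) \<partial>M)" by (simp add: integral_distr)
    also have "\<dots> = (\<integral>b. g (y (if b then 1 else - 1)) \<partial>bernoulli_pmf (\<eta> / (1 + \<eta>)))"
      unfolding M_def by (subst integral_distr) simp_all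
    also have "\<dots> = g 1 * (\<eta> / (1 + \<eta>)) + g (- \<eta>) * (1 - \<eta> / (1 + \<eta>))"
      using assms by (subst integral_bernoulli_pmf) (simp_all add: y_def)
    also have "1 - \<eta> / (1 + \<eta>) = 1 / (1 + \<eta>)" using assms by (simp add: field_simps)
    finally show ?thesis by (simp add: add_divide_distrib mult.commute)
  qed
  show ?thesis
  proof (rule that[OF P.prob_space_axioms ind _ _ ex])
    show "X j \<omega> \<in> {1, - \<eta>}" for j \<omega> by (simp add: X_def y_def)
    show "distr P borel (X j) = distr P borel (X 1)" for j unfolding dX ..
  qed
qed

text \<open>For the two-point law the third moment of the normalized sum divided by
  \<open>lyapunov\<close> is \<open>(1 - \<eta>\<^sup>2) / (1 + \<eta>\<^sup>2)\<close>, whatever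
  \<open>n\<close> is. It tends to 1 as \<eta> tends to 0.\<close>

lemma zeta_3_optimal:
  fixes \<delta> :: real
  assumes "0 < \<delta>"
    and N: "prob_space R" "distributed R lborel N (\<lambda>x. ennreal (std_normal_density x))"
  shows "\<exists>(P::(nat \<Rightarrow> real) measure) (X::nat \<Rightarrow> (nat \<Rightarrow> real) \<Rightarrow> real).
          prob_space P \<and> prob_space.indep_vars P (\<lambda>_. borel) X {1..} \<and>
          (\<forall>j\<ge>1. distr P borel (X j) = distr P borel (X 1)) \<and>
          centered_L3 P (X 1) \<and> prob_space.variance P (X 1) > 0 \<and>
          (\<forall>n\<ge>1. zeta 3 P (norm_sum P X n) R N / ereal (lyapunov P X n) \<ge> ereal (1 / 6 - \<delta>))"
proof -
  \<comment> \<open>The bound by 1 gives \<open>\<eta>\<^sup>2 \<le> \<eta>\<close>, the bound by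
    \<delta> then makes the loss \<open>2 * \<eta>\<^sup>2\<close> at most
    \<open>6 * \<delta>\<close>.\<close>
  define \<eta> where "\<eta> = min 1 \<delta>"
  have \<eta>: "0 < \<eta>" "\<eta> \<le> 1" "\<eta> \<le> \<delta>" using \<open>0 < \<delta>\<close> by (auto simp: \<eta>_def)
  obtain P :: "(nat \<Rightarrow> real) measure" and X :: "nat \<Rightarrow> (nat \<Rightarrow> real) \<Rightarrow> real"
    where P: "prob_space P" and indep: "prob_space.indep_vars P (\<lambda>_. borel) X UNIV"
      and two: "\<And>j \<omega>. X j \<omega> \<in> {1, - \<eta>}" and id: "\<And>j. distr P borel (X j) = distr P borel (X 1)"
      and ex: "\<And>j g. g \<in> borel_measurable borel \<Longrightarrow>
        prob_space.expectation P (\<lambda>\<omega>. g (X j \<omega>)) = (\<eta> * g 1 + g (- \<eta>)) / (1 + \<eta> :: real)"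
    by (rule two_point_iid_exists[OF \<eta>(1)]) (rule that)
  interpret P: prob_space P by fact
  have b: "\<bar>X j \<omega>\<bar> \<le> 1" for j \<omega> using two[of j \<omega>] \<eta> by auto
  have [measurable]: "X j \<in> borel_measurable P" for j using indep by (auto simp: P.indep_vars_def)
  have mean: "P.expectation (X j) = 0" for j using ex[of "\<lambda>x. x" j] by simp
  have var: "P.variance (X j) = \<eta>" for j
  proof -
    have "P.expectation (\<lambda>\<omega>. (X j \<omega>)\<^sup>2) = (\<eta> * 1\<^sup>2 + (- \<eta>)\<^sup>2) / (1 + \<eta>)" by (rule ex) simp
    also have "\<dots> = \<eta>" using \<eta> by (simp add: power2_eq_square field_simps)
    finally show ?thesis unfolding mean by simp
  qed
  have third: "P.expectation (\<lambda>\<omega>. X j \<omega> ^ 3) = \<eta> * (1 - \<eta>\<^sup>2) / (1 + \<eta>)" for j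
    using ex[of "\<lambda>x. x ^ 3" j] by (simp add: power2_eq_square power3_eq_cube field_simps)
  have abs3: "P.expectation (\<lambda>\<omega>. \<bar>X j \<omega>\<bar> ^ 3) = \<eta> * (1 + \<eta>\<^sup>2) / (1 + \<eta>)" for j
    using ex[of "\<lambda>x. \<bar>x\<bar> ^ 3" j] \<eta> by (simp add: power2_eq_square power3_eq_cube field_simps)
  have L3: "centered_L3 P (X j)" for j
  proof -
    have "\<bar>X j \<omega>\<bar> ^ 3 \<le> 1" for \<omega> using b[of j \<omega>] by (simp add: power_le_one)
    then show ?thesis
      unfolding centered_L3_def using b mean
      by (auto intro!: P.integrable_const_bound[of _ 1])
  qed
  have "ereal (1 / 6 - \<delta>) \<le> zeta 3 P (norm_sum P X n) R N / ereal (lyapunov P X n)" if n: "1 \<le> n" for n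
  proof -
    define \<sigma> where "\<sigma> = sigma_sum P X n"
    have \<sigma>: "\<sigma> = sqrt (real n * \<eta>)" unfolding \<sigma>_def sigma_sum_def var by simp
    then have \<sigma>0: "0 < \<sigma>" using n \<eta> by simp
    have ly: "lyapunov P X n = real n * (\<eta> * (1 + \<eta>\<^sup>2) / (1 + \<eta>)) / \<sigma> ^ 3"
      unfolding lyapunov_def abs3 \<sigma>_def by simp
    have "0 < 1 + \<eta>\<^sup>2" using zero_le_power2[of \<eta>] by linarith
    then have ly0: "0 < lyapunov P X n" unfolding ly using n \<eta> \<sigma>0 by simp
    have ind: "P.indep_vars (\<lambda>_. borel) X {1..n}" by (rule P.indep_vars_subset[OF indep]) simp
    note sm = P.sum_moments_bounded[OF finite_atLeastAtMost ind b mean]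
    have ns: "norm_sum P X n = (\<lambda>\<omega>. (\<Sum>j=1..n. X j \<omega>) / \<sigma>)"
      by (rule ext) (simp add: norm_sum_def \<sigma>_def)
    have c3: "P.expectation (\<lambda>\<omega>. norm_sum P X n \<omega> ^ 3) = real n * (\<eta> * (1 - \<eta>\<^sup>2) / (1 + \<eta>)) / \<sigma> ^ 3"
      unfolding ns power_divide using sm(2) by (simp add: third)
    have bS: "\<bar>norm_sum P X n \<omega>\<bar> \<le> (\<Sum>j=1..n. 1) / \<sigma>" for \<omega>
    proof -
      have "\<bar>\<Sum>j=1..n. X j \<omega>\<bar> \<le> (\<Sum>j=1..n. 1)" by (rule order_trans[OF sum_abs sum_mono]) (rule b)
      then show ?thesis unfolding ns abs_divide using \<sigma>0 by (simp add: divide_right_mono)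
    qed
    have "norm_sum P X n \<in> borel_measurable P" unfolding ns by measurable
    moreover have "P.expectation (norm_sum P X n) = 0" unfolding ns using sm(1) by simp
    ultimately have ge: "ereal (P.expectation (\<lambda>\<omega>. norm_sum P X n \<omega> ^ 3) / 6) \<le> zeta 3 P (norm_sum P X n) R N"
      by (intro zeta_3_ge_third_moment[OF P _ bS _ N])
    have "(1 + \<eta>\<^sup>2) * (1 / 6 - \<delta>) \<le> (1 - \<eta>\<^sup>2) / 6"
    proof -
      have "\<eta>\<^sup>2 \<le> \<eta>" using \<eta> by (simp add: power2_eq_square mult_left_le)
      moreover have "0 \<le> \<delta> * \<eta>\<^sup>2" using \<open>0 < \<delta>\<close> by simp
      ultimately have "2 * \<eta>\<^sup>2 \<le> 6 * \<delta> + 6 * (\<delta> * \<eta>\<^sup>2)" using \<eta> by linarith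
      then show ?thesis by (simp add: algebra_simps)
    qed
    \<comment> \<open>All dependence on \<open>n\<close> sits in this common factor, so one sequence
      serves every \<open>n\<close>.\<close>
    then have "(real n * \<eta> / (1 + \<eta>) / \<sigma> ^ 3) * ((1 + \<eta>\<^sup>2) * (1 / 6 - \<delta>)) \<le> (real n * \<eta> / (1 + \<eta>) / \<sigma> ^ 3) * ((1 - \<eta>\<^sup>2) / 6)"
      using \<eta> \<sigma>0 by (intro mult_left_mono) auto
    then have "lyapunov P X n * (1 / 6 - \<delta>) \<le> P.expectation (\<lambda>\<omega>. norm_sum P X n \<omega> ^ 3) / 6"
      unfolding ly c3 by (simp add: mult_ac)
    then have "ereal (lyapunov P X n * (1 / 6 - \<delta>)) \<le> zeta 3 P (norm_sum P X n) R N"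
      using ge by (meson ereal_less_eq(3) order_trans)
    then show ?thesis using ly0 by (subst ereal_le_divide_pos) auto
  qed
  moreover have "P.indep_vars (\<lambda>_. borel) X {1..}" by (rule P.indep_vars_subset[OF indep]) simp
  ultimately show ?thesis using P L3[of 1] id var[of 1] \<eta>(1) by (intro exI[of _ P] exI[of _ X]) auto
qed

theorem theorem4:
  fixes R :: "'c measure" and N :: "'c \<Rightarrow> real"
  assumes "prob_space R" and "distributed R lborel N (\<lambda>x. ennreal (std_normal_density x))"
  shows
    "(\<forall>(n::nat) (P::'a measure) (X::nat \<Rightarrow> 'a \<Rightarrow> real) (Q::'b measure) (V::'b \<Rightarrow> real).
        n \<ge> 1 \<and> prob_space P \<and> prob_space.indep_vars P (\<lambda>_. borel) X {1..n} \<and>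
        (\<forall>j\<in>{1..n}. centered_L3 P (X j)) \<and>
        (\<Sum>j=1..n. prob_space.variance P (X j)) > 0 \<and>
        zero_biased P (norm_sum P X n) Q V \<longrightarrow>
        (let S = norm_sum P X n; \<epsilon> = ereal (lyapunov P X n); z = zeta 1 P S Q V in
          zeta 1 P S R N \<le> 2 * z \<and> 2 * z \<le> \<epsilon> \<and>
          zeta 2 P S R N \<le> ereal (sqrt (2 * pi) / 4) * z \<and>
          ereal (sqrt (2 * pi) / 4) * z \<le> ereal (sqrt (2 * pi) / 8) * \<epsilon> \<and>
          zeta 3 P S R N \<le> ereal (1 / 3) * z \<and>
          ereal (1 / 3) * z \<le> ereal (1 / 6) * \<epsilon>)) \<and>
     (\<forall>\<delta>::real. \<delta> > 0 \<longrightarrow>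
        (\<exists>(P::(nat \<Rightarrow> real) measure) (X::nat \<Rightarrow> (nat \<Rightarrow> real) \<Rightarrow> real).
          prob_space P \<and> prob_space.indep_vars P (\<lambda>_. borel) X {1..} \<and>
          (\<forall>j\<ge>1. distr P borel (X j) = distr P borel (X 1)) \<and>
          centered_L3 P (X 1) \<and> prob_space.variance P (X 1) > 0 \<and>
          (\<forall>n\<ge>1. zeta 3 P (norm_sum P X n) R N / ereal (lyapunov P X n) \<ge> ereal (1 / 6 - \<delta>))))"
  using zeta_bounds[OF assms] zeta_3_optimal[OF _ assms] by blast

end
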